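(* Let $(M,\phi,\xi,\eta,g)$ be a $5$-dimensional nearly Sasakian (non-Sasakian) manifold, let $h$ be defined by $\nabla_X\xi=-\phi X+hX$, and let $\lambda\neq0$ be a real constant with $h^2=-\lambda^2(I-\eta\otimes\xi)$. Let $(\phi_i,\xi,\eta,g)$, $i\in\{1,2,3\}$, be the almost contact metric structures of the associated $SU(2)$-structure, i.e. $\phi_1=\frac1\lambda h$, $\phi_2=\frac1\lambda\phi h$, $\phi_3=\phi$. Then $(\phi_2,\xi,\eta,g)$ is nearly cosymplectic and $(\phi_1,\xi,\eta,g)$ is nearly $\alpha$-Sasakian with $\alpha=-\lambda$.
   Context: All manifolds are smooth and connected; $\nabla$ is the Levi-Civita connection of $g$. An almost contact metric structure $(\phi,\xi,\eta,g)$ on $M^{2n+1}$ consists of a $(1,1)$-tensor field $\phi$, a vector field $\xi$, a $1$-form $\eta$ and a Riemannian metric $g$ with $\phi^2=-I+\eta\otimes\xi$, $\eta(\xi)=1$, $g(\phi X,\phi Y)=g(X,Y)-\eta(X)\eta(Y)$. For all vector fields $X,Y$, such a structure is - Sasakian if $(\nabla_X\phi)Y=g(X,Y)\xi-\eta(Y)X$; - nearly Sasakian if $(\nabla_X\phi)Y+(\nabla_Y\phi)X=2g(X,Y)\xi-\eta(X)Y-\eta(Y)X$; - nearly $\alpha$-Sasakian, for a real number $\alpha\ne0$, if $(\nabla_X\phi)Y+(\nabla_Y\phi)X=\alpha(2g(X,Y)\xi-\eta(X)Y-\eta(Y)X)$; - nearly cosymplectic if $(\nabla_X\phi)Y+(\nabla_Y\phi)X=0$.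 On a $5$-dimensional nearly Sasakian non-Sasakian manifold there is always a nonzero real constant $\lambda$ with $h^2=-\lambda^2(I-\eta\otimes\xi)$, and the tensors $\phi_1,\phi_2,\phi_3$ above define almost contact metric structures with $\phi_i\phi_j=\phi_k=-\phi_j\phi_i$ for every even permutation $(i,j,k)$ of $(1,2,3)$. *)

theory Defs
  imports "HOL-Analysis.Analysis" "HOL-Library.Function_Algebras"
begin

text \<open>
  The conventions are those of O'Neill, Semi-Riemannian Geometry: a tangent vector at a point is a
  derivation of the ring of smooth real-valued functions, a vector field is a smooth assignment of
  tangent vectors, and tensor fields are maps that are multilinear over the ring of smooth functions.
  Sums, differences and products of functions and of vector fields are pointwise
  (from Function_Algebras).
\<close>

subsection \<open>Smooth manifolds\<close>

text \<open>Only meaningful for open \<open>S\<close>; then it is the usual notion of class \<open>C\<^sup>k\<close> on \<open>S\<close>.\<close>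

fun C_k_on :: "nat \<Rightarrow> 'e::euclidean_space set \<Rightarrow> ('e \<Rightarrow> 'b::real_normed_vector) \<Rightarrow> bool" where
  "C_k_on 0 S f \<longleftrightarrow> continuous_on S f"
| "C_k_on (Suc k) S f \<longleftrightarrow>
     (\<forall>x\<in>S. f differentiable (at x)) \<and>
     (\<forall>v. C_k_on k S (\<lambda>x. frechet_derivative f (at x) v))"

definition smooth_on :: "'e::euclidean_space set \<Rightarrow> ('e \<Rightarrow> 'b::real_normed_vector) \<Rightarrow> bool" where
  "smooth_on S f \<longleftrightarrow> (\<forall>k. C_k_on k S f)"

text \<open>A chart is a pair of its domain and its coordinate map, whose values outside the domain
  are irrelevant. The dimension of the manifold is that of the model space \<open>'e\<close>.\<close>

type_synonym ('m, 'e) chart = "'m set \<times> ('m \<Rightarrow> 'e)"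

definition is_chart :: "('m::topological_space, 'e::euclidean_space) chart \<Rightarrow> bool" where
  "is_chart c \<longleftrightarrow> (case c of (U, \<psi>) \<Rightarrow>
     open U \<and> open (\<psi> ` U) \<and> inj_on \<psi> U \<and> homeomorphism U (\<psi> ` U) \<psi> (inv_into U \<psi>))"

definition smooth_manifold ::
  "('m::{t2_space,second_countable_topology}, 'e::euclidean_space) chart set \<Rightarrow> bool" where
  "smooth_manifold A \<longleftrightarrow>
     (\<forall>c\<in>A. is_chart c) \<and>
     (\<Union>c\<in>A. fst c) = UNIV \<and>
     (\<forall>(U, \<psi>)\<in>A. \<forall>(V, \<theta>)\<in>A. smooth_on (\<psi> ` (U \<inter> V)) (\<theta> \<circ> inv_into U \<psi>))"

definition smooth_functions ::
  "('m::{t2_space,second_countable_topology}, 'e::euclidean_space) chart set \<Rightarrow> ('m \<Rightarrow> real) set" where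
  "smooth_functions A = {f. \<forall>(U, \<psi>)\<in>A. smooth_on (\<psi> ` U) (f \<circ> inv_into U \<psi>)}"

subsection \<open>Vector fields and tensor fields\<close>

text \<open>Tangent vectors are given the value \<open>0\<close> on non-smooth functions, so that equality
  of the HOL functions is equality of derivations.\<close>

definition tangent_space ::
  "('m::{t2_space,second_countable_topology}, 'e::euclidean_space) chart set
     \<Rightarrow> 'm \<Rightarrow> (('m \<Rightarrow> real) \<Rightarrow> real) set" where
  "tangent_space A p = {v.
     (\<forall>f. f \<notin> smooth_functions A \<longrightarrow> v f = 0) \<and>
     (\<forall>f\<in>smooth_functions A. \<forall>g\<in>smooth_functions A. v (f + g) = v f + v g) \<and>
     (\<forall>c. \<forall>f\<in>smooth_functions A. v (\<lambda>q. c * f q) = c * v f) \<and>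
     (\<forall>f\<in>smooth_functions A. \<forall>g\<in>smooth_functions A. v (f * g) = v f * g p + f p * v g)}"

type_synonym 'm vfield = "'m \<Rightarrow> ('m \<Rightarrow> real) \<Rightarrow> real"

definition vector_fields ::
  "('m::{t2_space,second_countable_topology}, 'e::euclidean_space) chart set \<Rightarrow> 'm vfield set" where
  "vector_fields A = {X.
     (\<forall>p. X p \<in> tangent_space A p) \<and>
     (\<forall>f\<in>smooth_functions A. (\<lambda>p. X p f) \<in> smooth_functions A)}"

definition vf_scale :: "('m \<Rightarrow> real) \<Rightarrow> 'm vfield \<Rightarrow> 'm vfield"  (infixr \<open>\<cdot>\<close> 75) where
  "a \<cdot> X = (\<lambda>p f. a p * X p f)"

definition vf_scaleR :: "real \<Rightarrow> 'm vfield \<Rightarrow> 'm vfield"  (infixr \<open>\<cdot>\<^sub>\<real>\<close> 75) where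
  "c \<cdot>\<^sub>\<real> X = (\<lambda>p f. c * X p f)"

definition vf_apply :: "'m vfield \<Rightarrow> ('m \<Rightarrow> real) \<Rightarrow> 'm \<Rightarrow> real" where
  "vf_apply X f = (\<lambda>p. X p f)"

definition lie_bracket :: "'m vfield \<Rightarrow> 'm vfield \<Rightarrow> 'm vfield" where
  "lie_bracket X Y = (\<lambda>p f. X p (vf_apply Y f) - Y p (vf_apply X f))"

definition one_form ::
  "('m::{t2_space,second_countable_topology}, 'e::euclidean_space) chart set
     \<Rightarrow> ('m vfield \<Rightarrow> 'm \<Rightarrow> real) \<Rightarrow> bool" where
  "one_form A \<eta> \<longleftrightarrow>
     (\<forall>X\<in>vector_fields A. \<eta> X \<in> smooth_functions A) \<and>
     (\<forall>X\<in>vector_fields A. \<forall>Y\<in>vector_fields A. \<eta> (X + Y) = \<eta> X + \<eta> Y) \<and>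
     (\<forall>a\<in>smooth_functions A. \<forall>X\<in>vector_fields A. \<eta> (a \<cdot> X) = a * \<eta> X)"

definition tensor_1_1 ::
  "('m::{t2_space,second_countable_topology}, 'e::euclidean_space) chart set
     \<Rightarrow> ('m vfield \<Rightarrow> 'm vfield) \<Rightarrow> bool" where
  "tensor_1_1 A \<phi> \<longleftrightarrow>
     (\<forall>X\<in>vector_fields A. \<phi> X \<in> vector_fields A) \<and>
     (\<forall>X\<in>vector_fields A. \<forall>Y\<in>vector_fields A. \<phi> (X + Y) = \<phi> X + \<phi> Y) \<and>
     (\<forall>a\<in>smooth_functions A. \<forall>X\<in>vector_fields A. \<phi> (a \<cdot> X) = a \<cdot> \<phi> X)"

subsection \<open>Riemannian metrics and the Levi-Civita connection\<close>

text \<open>Linearity in the second argument follows from symmetry.\<close>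

definition riemannian_metric ::
  "('m::{t2_space,second_countable_topology}, 'e::euclidean_space) chart set
     \<Rightarrow> ('m vfield \<Rightarrow> 'm vfield \<Rightarrow> 'm \<Rightarrow> real) \<Rightarrow> bool" where
  "riemannian_metric A g \<longleftrightarrow>
     (\<forall>Y\<in>vector_fields A. one_form A (\<lambda>X. g X Y)) \<and>
     (\<forall>X\<in>vector_fields A. \<forall>Y\<in>vector_fields A. g X Y = g Y X) \<and>
     (\<forall>X\<in>vector_fields A. \<forall>p. X p \<noteq> 0 \<longrightarrow> g X X p > 0)"

definition affine_connection ::
  "('m::{t2_space,second_countable_topology}, 'e::euclidean_space) chart set
     \<Rightarrow> ('m vfield \<Rightarrow> 'm vfield \<Rightarrow> 'm vfield) \<Rightarrow> bool" where
  "affine_connection A D \<longleftrightarrow>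
     (\<forall>Y\<in>vector_fields A. tensor_1_1 A (\<lambda>X. D X Y)) \<and>
     (\<forall>X\<in>vector_fields A. \<forall>Y\<in>vector_fields A. \<forall>Z\<in>vector_fields A.
        D X (Y + Z) = D X Y + D X Z) \<and>
     (\<forall>X\<in>vector_fields A. \<forall>a\<in>smooth_functions A. \<forall>Y\<in>vector_fields A.
        D X (a \<cdot> Y) = vf_apply X a \<cdot> Y + a \<cdot> D X Y)"

text \<open>On vector fields these conditions determine \<open>D\<close> uniquely (Koszul formula).\<close>

definition levi_civita ::
  "('m::{t2_space,second_countable_topology}, 'e::euclidean_space) chart set
     \<Rightarrow> ('m vfield \<Rightarrow> 'm vfield \<Rightarrow> 'm \<Rightarrow> real)
     \<Rightarrow> ('m vfield \<Rightarrow> 'm vfield \<Rightarrow> 'm vfield) \<Rightarrow> bool" where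
  "levi_civita A g D \<longleftrightarrow>
     affine_connection A D \<and>
     (\<forall>X\<in>vector_fields A. \<forall>Y\<in>vector_fields A. D X Y - D Y X = lie_bracket X Y) \<and>
     (\<forall>X\<in>vector_fields A. \<forall>Y\<in>vector_fields A. \<forall>Z\<in>vector_fields A.
        vf_apply X (g Y Z) = g (D X Y) Z + g Y (D X Z))"

text \<open>\<open>cov_deriv D \<phi> X Y\<close> is \<open>(D\<^sub>X \<phi>) Y\<close>.\<close>

definition cov_deriv ::
  "('m vfield \<Rightarrow> 'm vfield \<Rightarrow> 'm vfield) \<Rightarrow> ('m vfield \<Rightarrow> 'm vfield)
     \<Rightarrow> 'm vfield \<Rightarrow> 'm vfield \<Rightarrow> 'm vfield" where
  "cov_deriv D \<phi> X Y = D X (\<phi> Y) - \<phi> (D X Y)"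

subsection \<open>Almost contact metric structures\<close>

text \<open>In the classes of structures below, \<open>D\<close> is meant to be the Levi-Civita connection of \<open>g\<close>.\<close>

definition almost_contact_metric ::
  "('m::{t2_space,second_countable_topology}, 'e::euclidean_space) chart set
     \<Rightarrow> ('m vfield \<Rightarrow> 'm vfield) \<Rightarrow> 'm vfield \<Rightarrow> ('m vfield \<Rightarrow> 'm \<Rightarrow> real)
     \<Rightarrow> ('m vfield \<Rightarrow> 'm vfield \<Rightarrow> 'm \<Rightarrow> real) \<Rightarrow> bool" where
  "almost_contact_metric A \<phi> \<xi> \<eta> g \<longleftrightarrow>
     tensor_1_1 A \<phi> \<and> \<xi> \<in> vector_fields A \<and> one_form A \<eta> \<and> riemannian_metric A g \<and>
     (\<forall>X\<in>vector_fields A. \<phi> (\<phi> X) = - X + \<eta> X \<cdot> \<xi>) \<and>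
     \<eta> \<xi> = 1 \<and>
     (\<forall>X\<in>vector_fields A. \<forall>Y\<in>vector_fields A. g (\<phi> X) (\<phi> Y) = g X Y - \<eta> X * \<eta> Y)"

definition sasakian ::
  "('m::{t2_space,second_countable_topology}, 'e::euclidean_space) chart set
     \<Rightarrow> ('m vfield \<Rightarrow> 'm vfield \<Rightarrow> 'm vfield)
     \<Rightarrow> ('m vfield \<Rightarrow> 'm vfield) \<Rightarrow> 'm vfield \<Rightarrow> ('m vfield \<Rightarrow> 'm \<Rightarrow> real)
     \<Rightarrow> ('m vfield \<Rightarrow> 'm vfield \<Rightarrow> 'm \<Rightarrow> real) \<Rightarrow> bool" where
  "sasakian A D \<phi> \<xi> \<eta> g \<longleftrightarrow>
     almost_contact_metric A \<phi> \<xi> \<eta> g \<and>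
     (\<forall>X\<in>vector_fields A. \<forall>Y\<in>vector_fields A.
        cov_deriv D \<phi> X Y = g X Y \<cdot> \<xi> - \<eta> Y \<cdot> X)"

definition nearly_sasakian ::
  "('m::{t2_space,second_countable_topology}, 'e::euclidean_space) chart set
     \<Rightarrow> ('m vfield \<Rightarrow> 'm vfield \<Rightarrow> 'm vfield)
     \<Rightarrow> ('m vfield \<Rightarrow> 'm vfield) \<Rightarrow> 'm vfield \<Rightarrow> ('m vfield \<Rightarrow> 'm \<Rightarrow> real)
     \<Rightarrow> ('m vfield \<Rightarrow> 'm vfield \<Rightarrow> 'm \<Rightarrow> real) \<Rightarrow> bool" where
  "nearly_sasakian A D \<phi> \<xi> \<eta> g \<longleftrightarrow>
     almost_contact_metric A \<phi> \<xi> \<eta> g \<and>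
     (\<forall>X\<in>vector_fields A. \<forall>Y\<in>vector_fields A.
        cov_deriv D \<phi> X Y + cov_deriv D \<phi> Y X = 2 \<cdot>\<^sub>\<real> g X Y \<cdot> \<xi> - \<eta> X \<cdot> Y - \<eta> Y \<cdot> X)"

definition nearly_alpha_sasakian ::
  "('m::{t2_space,second_countable_topology}, 'e::euclidean_space) chart set
     \<Rightarrow> ('m vfield \<Rightarrow> 'm vfield \<Rightarrow> 'm vfield) \<Rightarrow> real
     \<Rightarrow> ('m vfield \<Rightarrow> 'm vfield) \<Rightarrow> 'm vfield \<Rightarrow> ('m vfield \<Rightarrow> 'm \<Rightarrow> real)
     \<Rightarrow> ('m vfield \<Rightarrow> 'm vfield \<Rightarrow> 'm \<Rightarrow> real) \<Rightarrow> bool" where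
  "nearly_alpha_sasakian A D \<alpha> \<phi> \<xi> \<eta> g \<longleftrightarrow>
     \<alpha> \<noteq> 0 \<and> almost_contact_metric A \<phi> \<xi> \<eta> g \<and>
     (\<forall>X\<in>vector_fields A. \<forall>Y\<in>vector_fields A.
        cov_deriv D \<phi> X Y + cov_deriv D \<phi> Y X
          = \<alpha> \<cdot>\<^sub>\<real> (2 \<cdot>\<^sub>\<real> g X Y \<cdot> \<xi> - \<eta> X \<cdot> Y - \<eta> Y \<cdot> X))"

definition nearly_cosymplectic ::
  "('m::{t2_space,second_countable_topology}, 'e::euclidean_space) chart set
     \<Rightarrow> ('m vfield \<Rightarrow> 'm vfield \<Rightarrow> 'm vfield)
     \<Rightarrow> ('m vfield \<Rightarrow> 'm vfield) \<Rightarrow> 'm vfield \<Rightarrow> ('m vfield \<Rightarrow> 'm \<Rightarrow> real)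
     \<Rightarrow> ('m vfield \<Rightarrow> 'm vfield \<Rightarrow> 'm \<Rightarrow> real) \<Rightarrow> bool" where
  "nearly_cosymplectic A D \<phi> \<xi> \<eta> g \<longleftrightarrow>
     almost_contact_metric A \<phi> \<xi> \<eta> g \<and>
     (\<forall>X\<in>vector_fields A. \<forall>Y\<in>vector_fields A.
        cov_deriv D \<phi> X Y + cov_deriv D \<phi> Y X = 0)"

end

theory Submission
  imports Defs
begin

text \<open>
  On the horizontal distribution \<open>\<eta> = 0\<close> consider the trilinear forms
  \<open>P(X,Y,Z) = g((\<nabla>\<^sub>X\<phi>)Y, Z)\<close> and \<open>Q(X,Y,Z) = g((\<nabla>\<^sub>Xh)Y, Z)\<close>. The nearly Sasakian condition makes
  \<open>P\<close> totally skew; differentiating \<open>\<phi>\<^sup>2\<close>, \<open>h\<^sup>2\<close> and \<open>\<phi>h + h\<phi> = 0\<close> gives relations under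
  \<open>\<phi>\<close> and \<open>h\<close>; and \<open>d(d\<eta>) = 0\<close> equates the cyclic sum of \<open>Q\<close> with \<open>3P\<close>. Since \<open>\<phi>\<close> and
  \<open>h/\<lambda>\<close> generate a quaternionic structure, these relations force \<open>P = Q = 0\<close> by linear algebra, in any
  dimension. The components of \<open>\<nabla>\<phi>\<close> and \<open>\<nabla>h\<close> involving \<open>\<xi>\<close> follow from \<open>\<nabla>\<xi> = -\<phi> + h\<close> and the
  cyclic identity, so that \<open>(\<nabla>\<^sub>X\<phi>)Y = g(X + \<phi>hX, Y)\<xi> - \<eta>(Y)(X + \<phi>hX) + \<eta>(X)\<phi>hY\<close> and
  \<open>(\<nabla>\<^sub>Xh)Y = (\<nabla>\<^sub>X\<phi>)Y - (1 + \<lambda>\<^sup>2)(g(X,Y)\<xi> - \<eta>(Y)X)\<close>, from which both claims are read off.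
\<close>

subsection \<open>Three-tensors over the quaternions\<close>

text \<open>To be used with \<open>S\<close> the horizontal fields, \<open>I\<close> =
  \<open>h / l\<close>, \<open>J\<close> = \<open>\<phi>\<close>, and \<open>P\<close>,
  \<open>Q\<close> the forms built from the covariant derivatives of \<open>\<phi>\<close> and
  \<open>h\<close> at a fixed point. Linearity is recorded as compatibility with negation, since the
  argument just moves quaternion units between slots.\<close>

locale quaternionic_three_tensors =
  fixes S :: "'a::ab_group_add set" and I J :: "'a \<Rightarrow> 'a"
    and P Q :: "'a \<Rightarrow> 'a \<Rightarrow> 'a \<Rightarrow> real" and l :: real
  assumes I_closed: "X \<in> S \<Longrightarrow> I X \<in> S"
    and J_closed: "X \<in> S \<Longrightarrow> J X \<in> S"
    and uminus_closed: "X \<in> S \<Longrightarrow> - X \<in> S"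
    and I_uminus: "X \<in> S \<Longrightarrow> I (- X) = - I X"
    and J_uminus: "X \<in> S \<Longrightarrow> J (- X) = - J X"
    and I_I: "X \<in> S \<Longrightarrow> I (I X) = - X"
    and J_J: "X \<in> S \<Longrightarrow> J (J X) = - X"
    and I_J: "X \<in> S \<Longrightarrow> I (J X) = - J (I X)"
    and P_uminus:
      "\<lbrakk>X \<in> S; Y \<in> S; Z \<in> S\<rbrakk> \<Longrightarrow> P (- X) Y Z = - P X Y Z"
      "\<lbrakk>X \<in> S; Y \<in> S; Z \<in> S\<rbrakk> \<Longrightarrow> P X (- Y) Z = - P X Y Z"
      "\<lbrakk>X \<in> S; Y \<in> S; Z \<in> S\<rbrakk> \<Longrightarrow> P X Y (- Z) = - P X Y Z"
    and Q_uminus: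
      "\<lbrakk>X \<in> S; Y \<in> S; Z \<in> S\<rbrakk> \<Longrightarrow> Q (- X) Y Z = - Q X Y Z"
      "\<lbrakk>X \<in> S; Y \<in> S; Z \<in> S\<rbrakk> \<Longrightarrow> Q X (- Y) Z = - Q X Y Z"
      "\<lbrakk>X \<in> S; Y \<in> S; Z \<in> S\<rbrakk> \<Longrightarrow> Q X Y (- Z) = - Q X Y Z"
    and P_skew12: "\<lbrakk>X \<in> S; Y \<in> S; Z \<in> S\<rbrakk> \<Longrightarrow> P X Y Z = - P Y X Z"
    and P_skew23: "\<lbrakk>X \<in> S; Y \<in> S; Z \<in> S\<rbrakk> \<Longrightarrow> P X Y Z = - P X Z Y"
    and Q_skew23: "\<lbrakk>X \<in> S; Y \<in> S; Z \<in> S\<rbrakk> \<Longrightarrow> Q X Y Z = - Q X Z Y"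
    and P_J: "\<lbrakk>X \<in> S; Y \<in> S; Z \<in> S\<rbrakk> \<Longrightarrow> P X (J Y) Z = P X Y (J Z)"
    and Q_I: "\<lbrakk>X \<in> S; Y \<in> S; Z \<in> S\<rbrakk> \<Longrightarrow> Q X (I Y) Z = Q X Y (I Z)"
    and Q_J: "\<lbrakk>X \<in> S; Y \<in> S; Z \<in> S\<rbrakk>
      \<Longrightarrow> Q X (J Y) Z - Q X Y (J Z) = l * (P X Y (I Z) - P X (I Y) Z)"
    and cyclic: "\<lbrakk>X \<in> S; Y \<in> S; Z \<in> S\<rbrakk> \<Longrightarrow> Q X Y Z + Q Y Z X + Q Z X Y = 3 * P X Y Z"
begin

lemmas closed = I_closed J_closed uminus_closed
lemmas units = I_uminus J_uminus I_I J_J I_J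

text \<open>\<open>P_J\<close> moves \<open>J\<close> between the last two slots and skew-symmetry
  carries it to the first, so \<open>J\<close> may stand in any slot of \<open>P\<close>.\<close>

lemma P_J_first:
  assumes "X \<in> S" "Y \<in> S" "Z \<in> S"
  shows "P X (J Y) Z = P (J X) Y Z" "P X Y (J Z) = P (J X) Y Z"
proof -
  show "P X Y (J Z) = P (J X) Y Z"
    using P_skew12[of X Y "J Z"] P_J[of Y X Z] P_skew12[of Y "J X" Z] assms by (simp add: closed)
  then show "P X (J Y) Z = P (J X) Y Z"
    using P_J assms by simp
qed

lemma P_rotate: "\<lbrakk>X \<in> S; Y \<in> S; Z \<in> S\<rbrakk> \<Longrightarrow> P Y Z X = P X Y Z"
  by (metis P_skew12 P_skew23)

text \<open>The correction of \<open>Q\<close> that anticommutes, as an endomorphism, with both \<open>I\<close> and \<open>J\<close>.\<close>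

definition q :: "'a \<Rightarrow> 'a \<Rightarrow> 'a \<Rightarrow> real" where
  "q X Y Z = Q X Y Z + l / 2 * (P X Y (J (I Z)) + P X (J (I Y)) Z)"

lemma q_uminus:
  assumes "X \<in> S" "Y \<in> S" "Z \<in> S"
  shows "q (- X) Y Z = - q X Y Z" "q X (- Y) Z = - q X Y Z" "q X Y (- Z) = - q X Y Z"
  using assms by (simp_all add: q_def P_uminus Q_uminus closed units algebra_simps)

lemma q_I: "\<lbrakk>X \<in> S; Y \<in> S; Z \<in> S\<rbrakk> \<Longrightarrow> q X Y (I Z) = q X (I Y) Z"
  by (simp add: q_def Q_I closed units P_uminus P_J_first)

text \<open>This fixes the factor \<open>l / 2\<close> in \<open>q\<close>: by \<open>Q_J\<close>
  the form \<open>Q\<close> misses the identity by a multiple of \<open>l\<close>, and each side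
  absorbs half of the defect.\<close>

lemma q_J: "\<lbrakk>X \<in> S; Y \<in> S; Z \<in> S\<rbrakk> \<Longrightarrow> q X Y (J Z) = q X (J Y) Z"
  using Q_J[of X Y Z]
  by (simp add: q_def closed units P_uminus P_J_first field_simps)

lemma q_skew23: "\<lbrakk>X \<in> S; Y \<in> S; Z \<in> S\<rbrakk> \<Longrightarrow> q X Y Z = - q X Z Y"
  using Q_skew23[of X Y Z] P_skew23[of X "J (I Y)" Z] P_skew23[of X Y "J (I Z)"]
  by (simp add: q_def closed units algebra_simps)

definition F :: "'a \<Rightarrow> 'a \<Rightarrow> 'a \<Rightarrow> real" where
  "F X Y Z = q X Y Z + q Y Z X + q Z X Y"

text \<open>The part from \<open>Q\<close> becomes \<open>3 * P\<close> by \<open>cyclic\<close>;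
  each correction term occurs twice in the cyclic sum, which cancels the factor 1/2.\<close>

lemma F_eq:
  assumes "X \<in> S" "Y \<in> S" "Z \<in> S"
  shows "F X Y Z = 3 * P X Y Z + l * (P (J X) (I Y) Z + P (J X) Y (I Z) + P (J (I X)) Y Z)"
proof -
  have "P Y Z (J (I X)) = P (J (I X)) Y Z" "P Y (J (I Z)) X = P X Y (J (I Z))"
    "P Z X (J (I Y)) = P X (J (I Y)) Z" "P Z (J (I X)) Y = P (J (I X)) Y Z"
    using assms by (metis P_rotate I_closed J_closed)+
  then show ?thesis
    using cyclic[OF assms] assms
    unfolding F_def q_def by (simp add: P_J_first closed algebra_simps)
qed

text \<open>The sum of \<open>F\<close> over the triples of quaternion units with product \<open>\<plusminus>1\<close>
  vanishes, because this already holds for \<open>q\<close> with the first unit fixed.\<close>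

lemma F_sum:
  assumes "X \<in> S" "Y \<in> S" "Z \<in> S"
  shows "F X Y Z - F (J X) (J Y) Z - F (J X) Y (J Z) - F X (J Y) (J Z)
    + F (I X) (I Y) Z + F (I X) Y (I Z) + F X (I Y) (I Z)
    - F X (J (I Y)) (J (I Z)) - F (J (I X)) Y (J (I Z)) - F (J (I X)) (J (I Y)) Z
    + F (J (I X)) (J Y) (I Z) + F (J X) (I Y) (J (I Z)) + F (J X) (J (I Y)) (I Z)
    + F (I X) (J (I Y)) (J Z) + F (I X) (J Y) (J (I Z)) + F (J (I X)) (I Y) (J Z) = 0"
  using assms by (simp add: F_def q_I q_J closed units q_uminus)

text \<open>Substitute \<open>F_eq\<close> into \<open>F_sum\<close>. Without \<open>l\<close>, only
  the four triples of units 1 and \<open>J\<close> survive, each giving \<open>3 * P X Y Z\<close>;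
  with \<open>l\<close>, the terms with a single \<open>I\<close> cancel and those with
  \<open>I\<close> in all three slots add up.\<close>

lemma P_eq:
  assumes "X \<in> S" "Y \<in> S" "Z \<in> S"
  shows "P X Y Z = - (l * P (J (I X)) (I Y) (I Z))"
proof -
  have "0 = 12 * P X Y Z + 12 * (l * P (J (I X)) (I Y) (I Z))"
    by (subst F_sum[OF assms, symmetric], simp add: F_eq assms closed units P_J_first P_uminus,
        simp add: algebra_simps)
  then show ?thesis
    by simp
qed

text \<open>\<open>P_eq\<close> applied twice gives \<open>P = - l * l * P\<close>, since the three
  units in it square to -1.\<close>

lemma P_zero:
  assumes "X \<in> S" "Y \<in> S" "Z \<in> S"
  shows "P X Y Z = 0"
proof -
  have "P X Y Z = - (l * P (J (I X)) (I Y) (I Z))"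
    by (rule P_eq[OF assms])
  also have "P (J (I X)) (I Y) (I Z) = l * P X Y Z"
    using assms by (subst P_eq) (simp_all add: closed units P_uminus)
  finally have "(1 + l\<^sup>2) * P X Y Z = 0"
    by (simp add: power2_eq_square algebra_simps)
  moreover have "1 + l\<^sup>2 > 0"
    by (rule add_pos_nonneg) auto
  ultimately show ?thesis
    by simp
qed

section \<open>From the vanishing of \<open>P\<close> to that of \<open>Q\<close>\<close>

lemma q_eq_Q: "\<lbrakk>X \<in> S; Y \<in> S; Z \<in> S\<rbrakk> \<Longrightarrow> q X Y Z = Q X Y Z"
  by (simp add: q_def P_zero closed)

lemma cyclic0: "\<lbrakk>X \<in> S; Y \<in> S; Z \<in> S\<rbrakk> \<Longrightarrow> q X Y Z + q Y Z X + q Z X Y = 0"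
  using cyclic by (simp add: q_eq_Q P_zero)

text \<open>As for the covariant derivative of an almost Kaehler structure.\<close>

lemma q_J12:
  assumes "X \<in> S" "Y \<in> S" "Z \<in> S"
  shows "q (J X) Y Z = q X (J Y) Z"
proof -
  \<comment> \<open>\<open>J\<close> is inserted in one slot of the cyclic identity, or in all
    three. The first plus the fourth equation minus the other two is twice the claim.\<close>
  have "q (J X) Y Z + q Y (J Z) X + q Z (J X) Y = 0"
    "q X (J Y) Z + q (J Y) Z X + q Z (J X) Y = 0"
    "q X (J Y) Z + q Y (J Z) X + q (J Z) X Y = 0"
    "q (J X) Y Z + q (J Y) Z X + q (J Z) X Y = 0"
    using cyclic0[of "J X" Y Z] cyclic0[of X "J Y" Z] cyclic0[of X Y "J Z"]
      cyclic0[of "J X" "J Y" "J Z"] assms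
    by (simp_all add: closed q_J units q_uminus)
  then show ?thesis
    by linarith
qed

lemma q_I12:
  assumes "X \<in> S" "Y \<in> S" "Z \<in> S"
  shows "q (I X) Y Z = q X (I Y) Z"
proof -
  have "q (I X) Y Z + q Y (I Z) X + q Z (I X) Y = 0"
    "q X (I Y) Z + q (I Y) Z X + q Z (I X) Y = 0"
    "q X (I Y) Z + q Y (I Z) X + q (I Z) X Y = 0"
    "q (I X) Y Z + q (I Y) Z X + q (I Z) X Y = 0"
    using cyclic0[of "I X" Y Z] cyclic0[of X "I Y" Z] cyclic0[of X Y "I Z"]
      cyclic0[of "I X" "I Y" "I Z"] assms
    by (simp_all add: closed q_I units q_uminus)
  then show ?thesis
    by linarith
qed

text \<open>The unit \<open>J I\<close> changes sign whenever it moves to a neighbouring slot of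
  \<open>q\<close>, because \<open>I\<close> and \<open>J\<close> anticommute; this conflicts with
  skew-symmetry in the last two slots unless \<open>q\<close> vanishes.\<close>

lemma Q_zero:
  assumes "X \<in> S" "Y \<in> S" "Z \<in> S"
  shows "Q X Y Z = 0"
proof -
  have K: "q (J (I U)) V W = 0" if "U \<in> S" "V \<in> S" "W \<in> S" for U V W
  proof -
    have "q (J (I U)) V W = - q (J (I U)) W V" "q U (J (I W)) V = - q U V (J (I W))"
      using that by (intro q_skew23; simp add: closed)+
    then show ?thesis
      using that by (simp add: closed q_I q_J q_J12 q_I12 units q_uminus)
  qed
  \<comment> \<open>\<open>J I\<close> squares to -1, so every first argument has the form required
    by \<open>K\<close>, up to sign.\<close>
  have "q (J (I (J (I X)))) Y Z = 0"
    using assms by (intro K) (simp_all add: closed)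
  then show ?thesis
    using assms by (simp add: closed units q_uminus flip: q_eq_Q)
qed

end

subsection \<open>Smooth functions and vector fields\<close>

lemma C_k_on_cong:
  assumes "open S" "\<And>x. x \<in> S \<Longrightarrow> f x = g x"
  shows "C_k_on k S f \<longleftrightarrow> C_k_on k S g"
  using assms(2)
proof (induction k arbitrary: f g)
  case 0
  then show ?case
    by (simp cong: continuous_on_cong)
next
  case (Suc k)
  have deriv: "(f has_derivative f') (at x) \<longleftrightarrow> (g has_derivative f') (at x)" if "x \<in> S" for x f'
    using has_derivative_transform_within_open[OF _ assms(1) that] Suc.prems by metis
  then have "f differentiable at x \<longleftrightarrow> g differentiable at x" if "x \<in> S" for x
    using that by (simp add: differentiable_def)
  moreover have "C_k_on k S (\<lambda>x. frechet_derivative f (at x) v) \<longleftrightarrow>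
      C_k_on k S (\<lambda>x. frechet_derivative g (at x) v)" for v
    by (rule Suc.IH) (simp add: frechet_derivative_def deriv)
  ultimately show ?case
    by simp
qed

lemma C_k_on_SucD: "C_k_on (Suc k) S f \<Longrightarrow> C_k_on k S f"
proof (induction k arbitrary: f)
  case 0
  then show ?case
    by (auto intro!: differentiable_imp_continuous_on differentiable_at_imp_differentiable_on)
qed auto

lemma C_k_on_const: "C_k_on k S (\<lambda>_. c)"
  by (induction k arbitrary: c) simp_all

lemma C_k_on_add:
  assumes "open S" "C_k_on k S f" "C_k_on k S g"
  shows "C_k_on k S (\<lambda>x. f x + g x)"
  using assms(2,3)
proof (induction k arbitrary: f g)
  case (Suc k)
  have "frechet_derivative (\<lambda>x. f x + g x) (at x) v =
      frechet_derivative f (at x) v + frechet_derivative g (at x) v" if "x \<in> S" for x v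
  proof -
    have "((\<lambda>x. f x + g x) has_derivative
        (\<lambda>h. frechet_derivative f (at x) h + frechet_derivative g (at x) h)) (at x)"
      using Suc.prems that by (intro has_derivative_add) (simp_all flip: frechet_derivative_works)
    then show ?thesis
      by (simp flip: frechet_derivative_at)
  qed
  then have "C_k_on k S (\<lambda>x. frechet_derivative (\<lambda>x. f x + g x) (at x) v) \<longleftrightarrow>
      C_k_on k S (\<lambda>x. frechet_derivative f (at x) v + frechet_derivative g (at x) v)" for v
    by (intro C_k_on_cong assms(1))
  then show ?case
    using Suc by simp
qed (simp add: continuous_on_add)

lemma C_k_on_mult:
  fixes f g :: "'e::euclidean_space \<Rightarrow> real"
  assumes "open S" "C_k_on k S f" "C_k_on k S g"
  shows "C_k_on k S (\<lambda>x. f x * g x)"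
  using assms(2,3)
proof (induction k arbitrary: f g)
  case (Suc k)
  have "frechet_derivative (\<lambda>x. f x * g x) (at x) v =
      f x * frechet_derivative g (at x) v + frechet_derivative f (at x) v * g x" if "x \<in> S" for x v
  proof -
    have "((\<lambda>x. f x * g x) has_derivative
        (\<lambda>h. f x * frechet_derivative g (at x) h + frechet_derivative f (at x) h * g x)) (at x)"
      using Suc.prems that by (intro has_derivative_mult) (simp_all flip: frechet_derivative_works)
    then show ?thesis
      by (simp flip: frechet_derivative_at)
  qed
  then have "C_k_on k S (\<lambda>x. frechet_derivative (\<lambda>x. f x * g x) (at x) v) \<longleftrightarrow>
      C_k_on k S (\<lambda>x. f x * frechet_derivative g (at x) v + frechet_derivative f (at x) v * g x)" for v
    by (intro C_k_on_cong assms(1))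
  \<comment> \<open>The product rule also contains the undifferentiated factors.\<close>
  moreover have "C_k_on k S f" "C_k_on k S g"
    using Suc.prems by (blast intro: C_k_on_SucD)+
  ultimately show ?case
    using Suc by (auto intro!: C_k_on_add assms(1))
qed (simp add: continuous_on_mult)

locale smooth_atlas =
  fixes A :: "('m::{t2_space,second_countable_topology}, 'e::euclidean_space) chart set"
  assumes manifold: "smooth_manifold A"
begin

abbreviation "C \<equiv> smooth_functions A"
abbreviation "V \<equiv> vector_fields A"

lemma open_chart_image: "(U, \<psi>) \<in> A \<Longrightarrow> open (\<psi> ` U)"
  using manifold by (fastforce simp: smooth_manifold_def is_chart_def)

lemma smooth_const: "(\<lambda>_. c) \<in> C"
  by (auto simp: smooth_functions_def smooth_on_def o_def C_k_on_const)

lemma smooth_one: "1 \<in> C"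
  using smooth_const[of 1] by (simp add: func_one)

lemma smooth_zero: "0 \<in> C"
  using smooth_const[of 0] by (simp add: func_zero)

lemma smooth_add: "f \<in> C \<Longrightarrow> k \<in> C \<Longrightarrow> f + k \<in> C"
  using open_chart_image by (force simp: smooth_functions_def smooth_on_def o_def intro!: C_k_on_add)

lemma smooth_mult: "f \<in> C \<Longrightarrow> k \<in> C \<Longrightarrow> f * k \<in> C"
  using open_chart_image by (force simp: smooth_functions_def smooth_on_def o_def intro!: C_k_on_mult)

lemma smooth_uminus: "f \<in> C \<Longrightarrow> - f \<in> C"
  using smooth_mult[OF smooth_const[of "- 1"], of f] by (simp add: times_fun_def fun_Compl_def)

lemma smooth_diff: "f \<in> C \<Longrightarrow> k \<in> C \<Longrightarrow> f - k \<in> C"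
  using smooth_add[OF _ smooth_uminus, of f k] by simp

lemma V_nonsmooth: "X \<in> V \<Longrightarrow> f \<notin> C \<Longrightarrow> X p f = 0"
  by (simp add: vector_fields_def tangent_space_def)

lemma V_add_fun: "X \<in> V \<Longrightarrow> f \<in> C \<Longrightarrow> k \<in> C \<Longrightarrow> X p (f + k) = X p f + X p k"
  by (simp add: vector_fields_def tangent_space_def)

lemma V_cmult_fun: "X \<in> V \<Longrightarrow> f \<in> C \<Longrightarrow> X p (\<lambda>q. c * f q) = c * X p f"
  by (simp add: vector_fields_def tangent_space_def)

lemma V_mult_fun: "X \<in> V \<Longrightarrow> f \<in> C \<Longrightarrow> k \<in> C \<Longrightarrow> X p (f * k) = X p f * k p + f p * X p k"
  by (simp add: vector_fields_def tangent_space_def)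

lemma V_diff_fun: "X \<in> V \<Longrightarrow> f \<in> C \<Longrightarrow> k \<in> C \<Longrightarrow> X p (f - k) = X p f - X p k"
  using V_add_fun[of X "f - k" k p] by (simp add: smooth_diff)

lemma V_uminus_fun: "X \<in> V \<Longrightarrow> f \<in> C \<Longrightarrow> X p (- f) = - X p f"
  using V_cmult_fun[of X f p "- 1"] by (simp add: fun_Compl_def)

lemma V_const:
  assumes "X \<in> V"
  shows "X p (\<lambda>_. c) = 0"
proof -
  have "X p 1 = 0"
    using V_mult_fun[OF assms smooth_one smooth_one, of p] by simp
  then show ?thesis
    using V_cmult_fun[OF assms smooth_one, of p c] by simp
qed

lemma V_zero_fun: "X \<in> V \<Longrightarrow> X p 0 = 0"
  using V_const[of X p 0] by (simp add: func_zero)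

lemma vf_apply_smooth: "X \<in> V \<Longrightarrow> f \<in> C \<Longrightarrow> vf_apply X f \<in> C"
  by (simp add: vector_fields_def vf_apply_def)

lemma V_add:
  assumes "X \<in> V" "Y \<in> V"
  shows "X + Y \<in> V"
proof -
  have "(\<lambda>p. X p f + Y p f) \<in> C" if "f \<in> C" for f
    using smooth_add[of "vf_apply X f" "vf_apply Y f"] vf_apply_smooth assms that
    by (simp add: vf_apply_def plus_fun_def)
  then show ?thesis
    using assms by (simp add: vector_fields_def tangent_space_def algebra_simps)
qed

lemma V_scale:
  assumes "a \<in> C" "X \<in> V"
  shows "a \<cdot> X \<in> V"
proof -
  have "(\<lambda>p. a p * X p f) \<in> C" if "f \<in> C" for f
    using smooth_mult[of a "vf_apply X f"] vf_apply_smooth assms that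
    by (simp add: vf_apply_def times_fun_def)
  then show ?thesis
    using assms by (simp add: vector_fields_def tangent_space_def vf_scale_def algebra_simps)
qed

text \<open>Lets linearity over smooth functions cover real multiples as well.\<close>

lemma scaleR_eq_scale: "c \<cdot>\<^sub>\<real> X = (\<lambda>_. c) \<cdot> X"
  by (simp add: vf_scaleR_def vf_scale_def)

lemma uminus_eq_scale: "- X = (\<lambda>_. - 1) \<cdot> (X :: 'm vfield)"
  by (simp add: vf_scale_def fun_Compl_def)

lemma scale_zero: "0 \<cdot> X = (0 :: 'm vfield)"
  by (simp add: vf_scale_def fun_eq_iff)

lemma scale_scaleR_add:
  "a \<cdot> X + c \<cdot>\<^sub>\<real> U + (b \<cdot> X + c \<cdot>\<^sub>\<real> W) = (a + b) \<cdot> X + c \<cdot>\<^sub>\<real> (U + W :: 'm vfield)"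
  by (simp add: vf_scaleR_def vf_scale_def fun_eq_iff distrib_left distrib_right add_ac)

lemma V_scaleR: "X \<in> V \<Longrightarrow> c \<cdot>\<^sub>\<real> X \<in> V"
  by (simp add: scaleR_eq_scale V_scale smooth_const)

lemma V_uminus: "X \<in> V \<Longrightarrow> - X \<in> V"
  by (simp only: uminus_eq_scale V_scale smooth_const)

lemma V_diff: "X \<in> V \<Longrightarrow> Y \<in> V \<Longrightarrow> X - Y \<in> V"
  using V_add[of X "- Y"] V_uminus by simp

lemmas V_closed = V_add V_scale V_scaleR V_uminus V_diff
lemmas C_closed = smooth_const smooth_one smooth_zero smooth_add smooth_mult smooth_uminus smooth_diff

section \<open>Lie brackets and the Jacobi identity\<close>

lemma vf_apply_lie_bracket:
  "vf_apply (lie_bracket X Y) f = vf_apply X (vf_apply Y f) - vf_apply Y (vf_apply X f)"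
  by (auto simp: vf_apply_def lie_bracket_def)

lemma lie_bracket_jacobi:
  assumes "X \<in> V" "Y \<in> V" "Z \<in> V"
  shows "lie_bracket (lie_bracket X Y) Z + lie_bracket (lie_bracket Y Z) X
    + lie_bracket (lie_bracket Z X) Y = 0"
proof (rule ext, rule ext)
  fix p f
  show "(lie_bracket (lie_bracket X Y) Z + lie_bracket (lie_bracket Y Z) X
      + lie_bracket (lie_bracket Z X) Y) p f = 0 p f"
  proof (cases "f \<in> C")
    case True
    then show ?thesis
      using assms unfolding plus_fun_apply lie_bracket_def
      by (simp add: vf_apply_lie_bracket[unfolded lie_bracket_def] vf_apply_smooth V_diff_fun)
  next
    \<comment> \<open>Tangent vectors have the default value 0 on non-smooth functions, so every
      bracket vanishes on \<open>f\<close>.\<close>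
    case False
    then have "vf_apply W f = 0" "vf_apply W 0 = 0" if "W \<in> V" for W
      using that V_nonsmooth V_zero_fun by (auto simp: vf_apply_def)
    then show ?thesis
      using assms unfolding plus_fun_apply lie_bracket_def
      by (simp add: vf_apply_lie_bracket[unfolded lie_bracket_def] V_zero_fun)
  qed
qed

end

section \<open>Linearity rules for (1,1)-tensors and one-forms\<close>

context smooth_atlas begin

lemma tensor_closed: "tensor_1_1 A F \<Longrightarrow> X \<in> V \<Longrightarrow> F X \<in> V"
  by (simp add: tensor_1_1_def)

lemma tensor_add: "tensor_1_1 A F \<Longrightarrow> X \<in> V \<Longrightarrow> Y \<in> V \<Longrightarrow> F (X + Y) = F X + F Y"
  by (simp add: tensor_1_1_def)

lemma tensor_scale: "tensor_1_1 A F \<Longrightarrow> a \<in> C \<Longrightarrow> X \<in> V \<Longrightarrow> F (a \<cdot> X) = a \<cdot> F X"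
  by (simp add: tensor_1_1_def)

lemma tensor_scaleR: "tensor_1_1 A F \<Longrightarrow> X \<in> V \<Longrightarrow> F (c \<cdot>\<^sub>\<real> X) = c \<cdot>\<^sub>\<real> F X"
  by (simp add: scaleR_eq_scale tensor_scale[of F] smooth_const)

lemma tensor_uminus: "tensor_1_1 A F \<Longrightarrow> X \<in> V \<Longrightarrow> F (- X) = - F X"
  by (simp only: uminus_eq_scale tensor_scale smooth_const)

lemma tensor_diff: "tensor_1_1 A F \<Longrightarrow> X \<in> V \<Longrightarrow> Y \<in> V \<Longrightarrow> F (X - Y) = F X - F Y"
  using tensor_add[of F X "- Y"] by (simp add: V_uminus tensor_uminus[of F])

lemma tensor_zero: "tensor_1_1 A F \<Longrightarrow> X \<in> V \<Longrightarrow> F 0 = 0"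
  using tensor_diff[of F X X] by simp

lemmas tensor_linear = tensor_add tensor_scale tensor_scaleR tensor_uminus tensor_diff

lemma tensor_compose: "tensor_1_1 A F \<Longrightarrow> tensor_1_1 A G \<Longrightarrow> tensor_1_1 A (\<lambda>X. F (G X))"
  by (simp add: tensor_1_1_def)

lemma tensor_scaleR_fun: "tensor_1_1 A F \<Longrightarrow> tensor_1_1 A (\<lambda>X. c \<cdot>\<^sub>\<real> F X)"
  by (auto simp: tensor_1_1_def V_scaleR)
     (auto simp: vf_scale_def vf_scaleR_def fun_eq_iff algebra_simps)

lemma form_closed: "one_form A \<theta> \<Longrightarrow> X \<in> V \<Longrightarrow> \<theta> X \<in> C"
  by (simp add: one_form_def)

lemma form_add: "one_form A \<theta> \<Longrightarrow> X \<in> V \<Longrightarrow> Y \<in> V \<Longrightarrow> \<theta> (X + Y) = \<theta> X + \<theta> Y"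
  by (simp add: one_form_def)

lemma form_scale: "one_form A \<theta> \<Longrightarrow> a \<in> C \<Longrightarrow> X \<in> V \<Longrightarrow> \<theta> (a \<cdot> X) = a * \<theta> X"
  by (simp add: one_form_def)

lemma form_scaleR: "one_form A \<theta> \<Longrightarrow> X \<in> V \<Longrightarrow> \<theta> (c \<cdot>\<^sub>\<real> X) = (\<lambda>_. c) * \<theta> X"
  by (simp add: scaleR_eq_scale form_scale[of \<theta>] smooth_const)

lemma form_uminus: "one_form A \<theta> \<Longrightarrow> X \<in> V \<Longrightarrow> \<theta> (- X) = - \<theta> X"
  by (simp add: uminus_eq_scale form_scale[of \<theta>] smooth_const) (simp add: fun_eq_iff)

lemma form_diff: "one_form A \<theta> \<Longrightarrow> X \<in> V \<Longrightarrow> Y \<in> V \<Longrightarrow> \<theta> (X - Y) = \<theta> X - \<theta> Y"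
  using form_add[of \<theta> X "- Y"] by (simp add: V_uminus form_uminus[of \<theta>])

lemma form_zero: "one_form A \<theta> \<Longrightarrow> X \<in> V \<Longrightarrow> \<theta> 0 = 0"
  using form_diff[of \<theta> X X] by simp

lemmas form_linear = form_add form_scale form_scaleR form_uminus form_diff

end

subsection \<open>The Levi-Civita connection\<close>

locale riemannian_atlas = smooth_atlas A
  for A :: "('m::{t2_space,second_countable_topology}, 'e::euclidean_space) chart set" +
  fixes g :: "'m vfield \<Rightarrow> 'm vfield \<Rightarrow> 'm \<Rightarrow> real"
    and D :: "'m vfield \<Rightarrow> 'm vfield \<Rightarrow> 'm vfield"
  assumes metric: "riemannian_metric A g"
    and connection: "levi_civita A g D"
begin

lemma g_sym: "X \<in> V \<Longrightarrow> Y \<in> V \<Longrightarrow> g X Y = g Y X"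
  using metric by (simp add: riemannian_metric_def)

lemma g_form_left: "Y \<in> V \<Longrightarrow> one_form A (\<lambda>X. g X Y)"
  using metric by (simp add: riemannian_metric_def)

lemma g_form_right:
  assumes "X \<in> V"
  shows "one_form A (g X)"
proof -
  have "one_form A (g X) \<longleftrightarrow> one_form A (\<lambda>Y. g Y X)"
    unfolding one_form_def using assms by (simp add: g_sym V_closed)
  then show ?thesis
    using assms g_form_left by simp
qed

lemma g_closed: "X \<in> V \<Longrightarrow> Y \<in> V \<Longrightarrow> g X Y \<in> C"
  using form_closed[OF g_form_right] .

lemmas g_linear = form_linear[OF g_form_left] form_linear[OF g_form_right]

lemma g_positive: "X \<in> V \<Longrightarrow> X p \<noteq> 0 \<Longrightarrow> g X X p > 0"
  using metric unfolding riemannian_metric_def by blast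

text \<open>Pair \<open>W\<close> with itself and use positivity at each point.\<close>

lemma g_nondegenerate:
  assumes "W \<in> V" "\<And>Z p. Z \<in> V \<Longrightarrow> g W Z p = 0"
  shows "W = 0"
proof
  fix p
  show "W p = 0 p"
    using g_positive[of W p] assms(2)[of W p] assms(1) unfolding zero_fun_apply by fastforce
qed

lemma D_tensor: "Y \<in> V \<Longrightarrow> tensor_1_1 A (\<lambda>X. D X Y)"
  using connection by (simp add: levi_civita_def affine_connection_def)

lemma D_closed: "X \<in> V \<Longrightarrow> Y \<in> V \<Longrightarrow> D X Y \<in> V"
  using tensor_closed[OF D_tensor] .

lemmas D_left = tensor_linear[OF D_tensor]

lemma D_add: "X \<in> V \<Longrightarrow> Y \<in> V \<Longrightarrow> Z \<in> V \<Longrightarrow> D X (Y + Z) = D X Y + D X Z"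
  using connection by (simp add: levi_civita_def affine_connection_def)

lemma D_scale: "X \<in> V \<Longrightarrow> a \<in> C \<Longrightarrow> Y \<in> V \<Longrightarrow> D X (a \<cdot> Y) = vf_apply X a \<cdot> Y + a \<cdot> D X Y"
  using connection by (simp add: levi_civita_def affine_connection_def)

lemma D_scaleR: "X \<in> V \<Longrightarrow> Y \<in> V \<Longrightarrow> D X (c \<cdot>\<^sub>\<real> Y) = c \<cdot>\<^sub>\<real> D X Y"
  by (simp add: scaleR_eq_scale D_scale smooth_const vf_apply_def V_const)
     (simp add: vf_scale_def fun_eq_iff)

lemma D_uminus: "X \<in> V \<Longrightarrow> Y \<in> V \<Longrightarrow> D X (- Y) = - D X Y"
  using D_scaleR[of X Y "-1"] by (simp add: uminus_eq_scale scaleR_eq_scale)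

lemma D_diff: "X \<in> V \<Longrightarrow> Y \<in> V \<Longrightarrow> Z \<in> V \<Longrightarrow> D X (Y - Z) = D X Y - D X Z"
  using D_add[of X Y "- Z"] by (simp add: V_uminus D_uminus)

lemma D_zero: "X \<in> V \<Longrightarrow> D X 0 = 0"
  using D_diff[of X X X] by simp

lemma torsion_free: "X \<in> V \<Longrightarrow> Y \<in> V \<Longrightarrow> lie_bracket X Y = D X Y - D Y X"
  using connection by (simp add: levi_civita_def)

lemma lie_bracket_closed: "X \<in> V \<Longrightarrow> Y \<in> V \<Longrightarrow> lie_bracket X Y \<in> V"
  by (simp add: torsion_free D_closed V_diff)

lemma metric_compatible:
  "X \<in> V \<Longrightarrow> Y \<in> V \<Longrightarrow> Z \<in> V \<Longrightarrow> vf_apply X (g Y Z) = g (D X Y) Z + g Y (D X Z)"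
  using connection by (simp add: levi_civita_def)

section \<open>Covariant derivatives of (1,1)-tensors\<close>

lemma cov_closed: "tensor_1_1 A F \<Longrightarrow> X \<in> V \<Longrightarrow> Y \<in> V \<Longrightarrow> cov_deriv D F X Y \<in> V"
  by (simp add: cov_deriv_def D_closed V_diff tensor_closed)

lemma cov_tensor_left:
  assumes F: "tensor_1_1 A F" and Y: "Y \<in> V"
  shows "tensor_1_1 A (\<lambda>X. cov_deriv D F X Y)"
proof -
  have "cov_deriv D F (X + X') Y = cov_deriv D F X Y + cov_deriv D F X' Y"
    if "X \<in> V" "X' \<in> V" for X X'
    using that Y by (simp add: cov_deriv_def D_left tensor_closed[OF F] tensor_linear[OF F] D_closed)
  moreover have "cov_deriv D F (a \<cdot> X) Y = a \<cdot> cov_deriv D F X Y" if "a \<in> C" "X \<in> V" for a X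
    using that Y by (simp add: cov_deriv_def D_left tensor_closed[OF F] tensor_linear[OF F] D_closed)
      (simp add: vf_scale_def fun_eq_iff algebra_simps)
  ultimately show ?thesis
    using assms by (simp add: tensor_1_1_def[of A "\<lambda>X. cov_deriv D F X Y"] cov_closed)
qed

text \<open>Both terms of \<open>cov_deriv\<close> produce the derivative of \<open>a\<close> times
  \<open>F Y\<close>; these cancel in the difference.\<close>

lemma cov_tensor_right:
  assumes F: "tensor_1_1 A F" and X: "X \<in> V"
  shows "tensor_1_1 A (cov_deriv D F X)"
proof -
  have "cov_deriv D F X (Y + Y') = cov_deriv D F X Y + cov_deriv D F X Y'"
    if "Y \<in> V" "Y' \<in> V" for Y Y'
    using that X by (simp add: cov_deriv_def D_add tensor_closed[OF F] tensor_linear[OF F] D_closed)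
  moreover have "cov_deriv D F X (a \<cdot> Y) = a \<cdot> cov_deriv D F X Y" if "a \<in> C" "Y \<in> V" for a Y
    using that X by (simp add: cov_deriv_def D_scale tensor_closed[OF F] tensor_linear[OF F]
        D_closed vf_apply_smooth V_scale)
      (simp add: vf_scale_def fun_eq_iff algebra_simps)
  ultimately show ?thesis
    using assms by (simp add: tensor_1_1_def[of A "cov_deriv D F X"] cov_closed)
qed

lemma cov_compose:
  assumes "tensor_1_1 A F" "tensor_1_1 A G" "X \<in> V" "Y \<in> V"
  shows "cov_deriv D (\<lambda>X. F (G X)) X Y = cov_deriv D F X (G Y) + F (cov_deriv D G X Y)"
  using assms by (simp add: cov_deriv_def tensor_diff[OF assms(1)] tensor_closed D_closed)

lemma cov_scaleR:
  assumes "tensor_1_1 A F" "X \<in> V" "Y \<in> V"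
  shows "cov_deriv D (\<lambda>X. c \<cdot>\<^sub>\<real> F X) X Y = c \<cdot>\<^sub>\<real> cov_deriv D F X Y"
  using assms by (simp add: cov_deriv_def D_scaleR tensor_closed)
    (simp add: vf_scaleR_def fun_eq_iff algebra_simps)

definition skew :: "('m vfield \<Rightarrow> 'm vfield) \<Rightarrow> bool" where
  "skew F \<longleftrightarrow> (\<forall>X\<in>V. \<forall>Y\<in>V. g (F X) Y = - g X (F Y))"

lemma skewD: "skew F \<Longrightarrow> X \<in> V \<Longrightarrow> Y \<in> V \<Longrightarrow> g (F X) Y p = - g X (F Y) p"
  by (simp add: skew_def)

text \<open>Differentiate \<open>g (F Y) Z = - g Y (F Z)\<close> along \<open>X\<close> by metric
  compatibility.\<close>

lemma cov_skew:
  assumes F: "tensor_1_1 A F" and "skew F" "X \<in> V"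
  shows "skew (cov_deriv D F X)"
  unfolding skew_def
proof (intro ballI ext)
  fix Y Z p assume Y: "Y \<in> V" and Z: "Z \<in> V"
  note [simp] = tensor_closed[OF F] D_closed
  have "g (F Y) Z = - g Y (F Z)"
    using assms Y Z by (simp add: skew_def)
  then have "vf_apply X (g (F Y) Z) p = - vf_apply X (g Y (F Z)) p"
    using assms Y Z by (simp add: vf_apply_def V_uminus_fun g_closed)
  then have "g (D X (F Y)) Z p + g (F Y) (D X Z) p = - (g (D X Y) (F Z) p + g Y (D X (F Z)) p)"
    using assms Y Z by (simp add: metric_compatible)
  moreover have "g (F (D X Y)) Z p = - g (D X Y) (F Z) p" "g (F Y) (D X Z) p = - g Y (F (D X Z)) p"
    using assms Y Z by (simp_all add: skewD[OF assms(2)])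
  ultimately show "g (cov_deriv D F X Y) Z p = (- g Y (cov_deriv D F X Z)) p"
    using assms Y Z by (simp add: cov_deriv_def g_linear)
qed

text \<open>This is \<open>d\<^sup>2 = 0\<close> for the one-form dual to the Killing field \<open>\<xi>\<close>, whose exterior derivative
  is \<open>2g(F X, Y)\<close>.\<close>

lemma cov_Killing_cyclic:
  assumes F: "tensor_1_1 A F" and skew: "skew F" and xi: "\<xi> \<in> V" and F_eq: "\<And>X. X \<in> V \<Longrightarrow> F X = D X \<xi>"
    and X: "X \<in> V" and Y: "Y \<in> V" and Z: "Z \<in> V"
  shows "g (cov_deriv D F X Y) Z p + g (cov_deriv D F Y Z) X p + g (cov_deriv D F Z X) Y p = 0"
proof -
  note [simp] = tensor_closed[OF F] D_closed g_closed lie_bracket_closed vf_apply_smooth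
  define u where "u X = g \<xi> X" for X
  have [simp]: "u X \<in> C" if "X \<in> V" for X
    using that xi by (simp add: u_def)
  \<comment> \<open>The exterior derivative of \<open>u\<close>, evaluated by the invariant
    formula.\<close>
  have two: "(\<lambda>_. 2) * g (F Y) Z = vf_apply Y (u Z) - vf_apply Z (u Y) - u (lie_bracket Y Z)"
    if "Y \<in> V" "Z \<in> V" for Y Z
  proof -
    have "g (F Z) Y p = - g (F Y) Z p" for p
      using skew that g_sym[of Z "F Y"] by (simp add: skewD[OF skew])
    then show ?thesis
      using that xi by (simp add: u_def metric_compatible torsion_free g_linear fun_eq_iff flip: F_eq)
  qed
  have dtwo: "2 * vf_apply X (g (F Y) Z) p = vf_apply X (vf_apply Y (u Z)) p
      - vf_apply X (vf_apply Z (u Y)) p - vf_apply X (u (lie_bracket Y Z)) p"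
    if "X \<in> V" "Y \<in> V" "Z \<in> V" for X Y Z
  proof -
    have "2 * vf_apply X (g (F Y) Z) p = X p ((\<lambda>_. 2) * g (F Y) Z)"
      using that V_cmult_fun[of X "g (F Y) Z" p 2] by (simp add: vf_apply_def times_fun_def)
    also have "\<dots> = vf_apply X (vf_apply Y (u Z)) p
      - vf_apply X (vf_apply Z (u Y)) p - vf_apply X (u (lie_bracket Y Z)) p"
      using that by (simp add: two V_diff_fun smooth_diff) (simp add: vf_apply_def)
    finally show ?thesis .
  qed
  have btwo: "2 * g (F (lie_bracket X Y)) Z p = vf_apply X (vf_apply Y (u Z)) p
      - vf_apply Y (vf_apply X (u Z)) p - vf_apply Z (u (lie_bracket X Y)) p
      - u (lie_bracket (lie_bracket X Y) Z) p"
    if "X \<in> V" "Y \<in> V" "Z \<in> V" for X Y Z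
    using fun_cong[OF two[of "lie_bracket X Y" Z], of p] that
    by (simp add: vf_apply_lie_bracket)
  have cov: "g (cov_deriv D F X Y) Z p
      = vf_apply X (g (F Y) Z) p - g (F Y) (D X Z) p - g (F (D X Y)) Z p"
    if "X \<in> V" "Y \<in> V" "Z \<in> V" for X Y Z
    using that by (simp add: cov_deriv_def g_linear metric_compatible)
  \<comment> \<open>Summed cyclically, this turns the bracket terms of the exterior derivative into
    the connection terms of \<open>cov\<close>.\<close>
  have bracket: "g (F (lie_bracket X Y)) Z p = g (F (D X Y)) Z p + g (F Z) (D Y X) p"
    if "X \<in> V" "Y \<in> V" "Z \<in> V" for X Y Z
    using that skew g_sym[of "F (D Y X)" Z]
    by (simp add: torsion_free tensor_diff[OF F] g_linear skewD[OF skew])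
  have "u (lie_bracket (lie_bracket X Y) Z) p + u (lie_bracket (lie_bracket Y Z) X) p
      + u (lie_bracket (lie_bracket Z X) Y) p
      = u (lie_bracket (lie_bracket X Y) Z + lie_bracket (lie_bracket Y Z) X
        + lie_bracket (lie_bracket Z X) Y) p"
    using X Y Z xi by (simp add: u_def g_linear V_add)
  also have "\<dots> = 0"
    using form_zero[OF g_form_right[OF xi] xi] lie_bracket_jacobi[OF X Y Z] by (simp add: u_def)
  \<comment> \<open>In the cyclic sum the second derivatives of \<open>u\<close> cancel, leaving
    only the Jacobi sum.\<close>
  finally show ?thesis
    using cov[OF X Y Z] cov[OF Y Z X] cov[OF Z X Y] bracket[OF X Y Z] bracket[OF Y Z X] bracket[OF Z X Y]
      dtwo[OF X Y Z] dtwo[OF Y Z X] dtwo[OF Z X Y] btwo[OF X Y Z] btwo[OF Y Z X] btwo[OF Z X Y]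
    by linarith
qed

end

subsection \<open>Almost contact metric structures\<close>

locale almost_contact_atlas = riemannian_atlas A g D
  for A :: "('m::{t2_space,second_countable_topology}, 'e::euclidean_space) chart set"
    and g D +
  fixes \<phi> :: "'m vfield \<Rightarrow> 'm vfield" and \<xi> :: "'m vfield" and \<eta> :: "'m vfield \<Rightarrow> 'm \<Rightarrow> real"
  assumes acm: "almost_contact_metric A \<phi> \<xi> \<eta> g"
begin

lemma phi_tensor: "tensor_1_1 A \<phi>"
  and xi_closed: "\<xi> \<in> V"
  and eta_form: "one_form A \<eta>"
  and phi_phi: "X \<in> V \<Longrightarrow> \<phi> (\<phi> X) = - X + \<eta> X \<cdot> \<xi>"
  and eta_xi: "\<eta> \<xi> = 1"
  and g_phi_phi: "X \<in> V \<Longrightarrow> Y \<in> V \<Longrightarrow> g (\<phi> X) (\<phi> Y) = g X Y - \<eta> X * \<eta> Y"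
  using acm by (simp_all add: almost_contact_metric_def)

lemmas phi_closed = tensor_closed[OF phi_tensor]
lemmas phi_linear = tensor_linear[OF phi_tensor]
lemmas eta_closed = form_closed[OF eta_form]
lemmas eta_linear = form_linear[OF eta_form]

text \<open>The square \<open>\<phi> (\<phi> \<xi>)\<close> is zero, so the formula for the square
  at \<open>\<phi> \<xi>\<close> makes \<open>\<phi> \<xi>\<close> a multiple
  \<open>c \<cdot> \<xi>\<close>; applying \<open>\<phi>\<close> again gives
  \<open>c * c = 0\<close>.\<close>

lemma phi_xi: "\<phi> \<xi> = 0"
proof -
  define c where "c = \<eta> (\<phi> \<xi>)"
  have c: "c \<in> C"
    by (simp add: c_def eta_closed phi_closed xi_closed)
  have "\<phi> (\<phi> \<xi>) = 0"
    by (simp add: phi_phi xi_closed eta_xi) (simp add: vf_scale_def fun_eq_iff)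
  moreover from this have phi_xi: "\<phi> \<xi> = c \<cdot> \<xi>"
    using phi_phi[OF phi_closed[OF xi_closed]] tensor_zero[OF phi_tensor xi_closed]
    by (simp add: c_def eq_neg_iff_add_eq_0)
  ultimately have "c \<cdot> c \<cdot> \<xi> = 0"
    using c by (metis phi_linear(2) xi_closed)
  moreover have "\<eta> (c \<cdot> c \<cdot> \<xi>) = c * c"
    using c by (simp add: eta_linear V_scale xi_closed eta_xi)
  ultimately have "c * c = 0"
    using form_zero[OF eta_form xi_closed] by simp
  then have "c = 0"
    by (simp add: fun_eq_iff)
  then show ?thesis
    by (simp add: phi_xi) (simp add: vf_scale_def fun_eq_iff)
qed

lemma eta_eq: "X \<in> V \<Longrightarrow> \<eta> X = g X \<xi>"
  using g_phi_phi[of X \<xi>] form_zero[OF g_form_right[OF phi_closed] xi_closed, of X]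
  by (simp add: xi_closed phi_xi eta_xi)

text \<open>The cube of \<open>\<phi>\<close> is computed in two ways.\<close>

lemma eta_phi:
  assumes "X \<in> V"
  shows "\<eta> (\<phi> X) = 0"
proof -
  have "\<phi> (- X + \<eta> X \<cdot> \<xi>) = - \<phi> X + \<eta> (\<phi> X) \<cdot> \<xi>"
    using phi_phi[OF assms] phi_phi[OF phi_closed[OF assms]] by simp
  moreover have "\<phi> (- X + \<eta> X \<cdot> \<xi>) = - \<phi> X + \<eta> X \<cdot> 0"
    using assms by (simp only: phi_linear V_closed eta_closed xi_closed phi_xi)
  ultimately have "\<eta> (\<phi> X) \<cdot> \<xi> = 0"
    by (simp add: vf_scale_def fun_eq_iff)
  then have "\<eta> (\<eta> (\<phi> X) \<cdot> \<xi>) = 0"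
    using form_zero[OF eta_form xi_closed] by simp
  then show ?thesis
    using assms by (simp add: eta_linear eta_closed phi_closed xi_closed eta_xi)
qed

text \<open>Apply \<open>g_phi_phi\<close> to \<open>X\<close> and \<open>\<phi> Y\<close>, then
  expand the square of \<open>\<phi>\<close>.\<close>

lemma phi_skew: "skew \<phi>"
  unfolding skew_def
proof (intro ballI)
  fix X Y assume "X \<in> V" "Y \<in> V"
  then have "g (\<phi> X) (\<phi> (\<phi> Y)) = g X (\<phi> Y)"
    by (simp add: g_phi_phi phi_closed eta_phi)
  moreover have "g (\<phi> X) (\<phi> (\<phi> Y)) = - g (\<phi> X) Y + \<eta> Y * g (\<phi> X) \<xi>"
    using \<open>X \<in> V\<close> \<open>Y \<in> V\<close>
    by (simp only: phi_phi g_linear V_closed phi_closed eta_closed xi_closed)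
  ultimately have "- g (\<phi> X) Y = g X (\<phi> Y)"
    using \<open>X \<in> V\<close> by (simp add: phi_closed eta_phi flip: eta_eq)
  then show "g (\<phi> X) Y = - g X (\<phi> Y)"
    by (metis minus_minus)
qed

section \<open>Horizontal and vertical components\<close>

definition horizontal :: "'m vfield set" where
  "horizontal = {X \<in> V. \<eta> X = 0}"

definition hor :: "'m vfield \<Rightarrow> 'm vfield" where
  "hor X = X - \<eta> X \<cdot> \<xi>"

lemma horizontalD: "X \<in> horizontal \<Longrightarrow> X \<in> V" "X \<in> horizontal \<Longrightarrow> \<eta> X = 0"
  by (simp_all add: horizontal_def)

lemma hor_closed: "X \<in> V \<Longrightarrow> hor X \<in> V"
  by (simp add: hor_def V_closed eta_closed xi_closed)

lemma hor_horizontal: "X \<in> V \<Longrightarrow> hor X \<in> horizontal"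
  by (simp add: horizontal_def hor_closed)
     (simp add: hor_def eta_linear V_scale eta_closed xi_closed eta_xi)

lemma hor_decomp: "X = hor X + \<eta> X \<cdot> \<xi>"
  by (simp add: hor_def)

text \<open>The projection \<open>hor\<close> is self-adjoint, so \<open>hor W\<close> is orthogonal
  to all fields.\<close>

lemma vertical_if_orthogonal:
  assumes "W \<in> V" "\<And>Z p. Z \<in> horizontal \<Longrightarrow> g W Z p = 0"
  shows "W = \<eta> W \<cdot> \<xi>"
proof -
  have "hor W = 0"
  proof (rule g_nondegenerate)
    fix Z p assume Z: "Z \<in> V"
    have "g (hor W) Z p = g W (hor Z) p"
      using assms(1) Z by (simp add: hor_def g_linear V_scale eta_closed xi_closed eta_eq g_sym[of \<xi> Z] g_closed)
    then show "g (hor W) Z p = 0"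
      using assms(2) Z hor_horizontal by simp
  qed (simp add: hor_closed assms(1))
  then show ?thesis
    by (simp add: hor_def)
qed

text \<open>\<xi> has constant length 1.\<close>

lemma eta_D_xi:
  assumes "X \<in> V"
  shows "\<eta> (D X \<xi>) = 0"
proof -
  have "g \<xi> \<xi> = (\<lambda>_. 1)"
    using eta_eq[OF xi_closed] eta_xi by (simp add: func_one)
  then have "vf_apply X (g \<xi> \<xi>) = 0"
    using V_const[OF assms, of _ 1] by (auto simp: vf_apply_def)
  then show ?thesis
    using assms g_sym[of \<xi> "D X \<xi>"] by (simp add: metric_compatible D_closed xi_closed eta_eq fun_eq_iff)
qed

text \<open>Differentiating \<open>F\<^sup>2 = c(I - \<eta> \<otimes> \<xi>)\<close>.\<close>

lemma cov_square:
  assumes F: "tensor_1_1 A F" and "skew F"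
    and F_F: "\<And>X. X \<in> V \<Longrightarrow> F (F X) = c \<cdot>\<^sub>\<real> hor X"
    and X: "X \<in> V" and Y: "Y \<in> horizontal" and Z: "Z \<in> horizontal"
  shows "g (cov_deriv D F X (F Y)) Z p = g (cov_deriv D F X Y) (F Z) p"
proof -
  note [simp] = horizontalD[OF Y] horizontalD[OF Z] X D_closed tensor_closed[OF F]
    cov_closed[OF F] xi_closed V_closed eta_closed
  have "F (F Y) = c \<cdot>\<^sub>\<real> Y"
    by (simp add: F_F hor_def) (simp add: vf_scaleR_def vf_scale_def fun_eq_iff)
  then have "cov_deriv D F X (F Y) + F (cov_deriv D F X Y) = c \<cdot>\<^sub>\<real> D X Y - c \<cdot>\<^sub>\<real> hor (D X Y)"
    using cov_compose[OF F F X, of Y] by (simp add: D_scaleR F_F cov_deriv_def[of D "\<lambda>X. F (F X)"])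
  \<comment> \<open>The remainder is vertical, so pairing with the horizontal \<open>Z\<close> kills
    it.\<close>
  also have "\<dots> = ((\<lambda>_. c) * \<eta> (D X Y)) \<cdot> \<xi>"
    by (simp add: hor_def vf_scaleR_def vf_scale_def fun_eq_iff algebra_simps)
  finally have "g (cov_deriv D F X (F Y) + F (cov_deriv D F X Y)) Z p = c * \<eta> (D X Y) p * g \<xi> Z p"
    by (simp add: g_linear C_closed)
  moreover have "g \<xi> Z p = 0"
    using eta_eq[of Z] g_sym[of \<xi> Z] by (simp add: fun_eq_iff)
  moreover have "g (F (cov_deriv D F X Y)) Z p = - g (cov_deriv D F X Y) (F Z) p"
    using skewD[OF assms(2)] by simp
  ultimately show ?thesis
    by (simp add: g_linear)
qed

end

subsection \<open>Nearly Sasakian structures\<close>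

locale nearly_sasakian_atlas = almost_contact_atlas A g D \<phi> \<xi> \<eta>
  for A :: "('m::{t2_space,second_countable_topology}, 'e::euclidean_space) chart set"
    and g D \<phi> \<xi> \<eta> +
  fixes h :: "'m vfield \<Rightarrow> 'm vfield"
  assumes ns: "nearly_sasakian A D \<phi> \<xi> \<eta> g"
    and D_xi: "X \<in> V \<Longrightarrow> D X \<xi> = - \<phi> X + h X"
begin

lemma cov_phi_sym: "X \<in> V \<Longrightarrow> Y \<in> V \<Longrightarrow>
    cov_deriv D \<phi> X Y + cov_deriv D \<phi> Y X = 2 \<cdot>\<^sub>\<real> g X Y \<cdot> \<xi> - \<eta> X \<cdot> Y - \<eta> Y \<cdot> X"
  using ns by (simp add: nearly_sasakian_def)

lemma h_eq: "X \<in> V \<Longrightarrow> h X = D X \<xi> + \<phi> X"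
  by (simp add: D_xi)

lemma h_tensor: "tensor_1_1 A h"
proof -
  have "h (X + Y) = h X + h Y" if "X \<in> V" "Y \<in> V" for X Y
    using that by (simp add: h_eq V_closed D_left phi_linear xi_closed)
  moreover have "h (a \<cdot> X) = a \<cdot> h X" if "a \<in> C" "X \<in> V" for a X
    using that by (simp add: h_eq V_closed D_left phi_linear xi_closed)
      (simp add: vf_scale_def fun_eq_iff algebra_simps)
  ultimately show ?thesis
    by (simp add: tensor_1_1_def[of A h]) (simp add: h_eq V_closed D_closed phi_closed xi_closed)
qed

lemmas h_closed = tensor_closed[OF h_tensor]
lemmas h_linear = tensor_linear[OF h_tensor]

lemma eta_h: "X \<in> V \<Longrightarrow> \<eta> (h X) = 0"
  using eta_D_xi by (simp add: h_eq eta_linear D_closed phi_closed xi_closed eta_phi)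

text \<open>The nearly Sasakian condition at \<open>\<xi>\<close>, \<open>\<xi>\<close> puts
  \<open>D \<xi> \<xi>\<close> in the kernel of \<open>\<phi>\<close>, while \<open>eta_D_xi\<close>
  excludes a vertical part.\<close>

lemma D_xi_xi: "D \<xi> \<xi> = 0"
proof -
  note [simp] = xi_closed D_closed
  have "cov_deriv D \<phi> \<xi> \<xi> + cov_deriv D \<phi> \<xi> \<xi> = 0"
    by (simp add: cov_phi_sym eta_xi flip: eta_eq) (simp add: vf_scaleR_def vf_scale_def fun_eq_iff)
  then have "\<phi> (D \<xi> \<xi>) = 0"
    by (simp add: cov_deriv_def phi_xi D_zero fun_eq_iff)
  then have "\<phi> (\<phi> (D \<xi> \<xi>)) = 0"
    using tensor_zero[OF phi_tensor xi_closed] by simp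
  then show ?thesis
    by (simp add: phi_phi eta_D_xi) (simp add: vf_scale_def fun_eq_iff)
qed

lemma h_xi: "h \<xi> = 0"
  by (simp add: h_eq xi_closed D_xi_xi phi_xi)

lemma cov_phi_xi_right:
  assumes "X \<in> V"
  shows "cov_deriv D \<phi> X \<xi> = - X + \<eta> X \<cdot> \<xi> - \<phi> (h X)"
  using assms by (simp add: cov_deriv_def phi_xi D_zero D_xi phi_linear phi_closed h_closed V_closed phi_phi)

lemma cov_phi_xi_left:
  assumes "X \<in> V"
  shows "cov_deriv D \<phi> \<xi> X = \<phi> (h X)"
proof -
  have "cov_deriv D \<phi> \<xi> X = (2 \<cdot>\<^sub>\<real> \<eta> X \<cdot> \<xi> - \<eta> X \<cdot> \<xi> - X) - cov_deriv D \<phi> X \<xi>"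
    using cov_phi_sym[OF assms xi_closed] assms
    by (simp add: eta_xi flip: eta_eq) (simp add: vf_scaleR_def vf_scale_def fun_eq_iff algebra_simps)
  then show ?thesis
    using assms by (simp add: cov_phi_xi_right vf_scaleR_def vf_scale_def fun_eq_iff)
qed

text \<open>This composition is the covariant derivative of the skew tensor \<open>\<phi>\<close>
  along \<xi>.\<close>

lemma phi_h_skew: "skew (\<lambda>X. \<phi> (h X))"
  using cov_skew[OF phi_tensor phi_skew xi_closed] by (simp add: skew_def cov_phi_xi_left)

text \<open>Differentiate the square of \<open>\<phi>\<close> along \<xi>: the result vanishes, so
  \<open>\<phi>\<close> kills \<open>h (\<phi> X) + \<phi> (h X)\<close>, which is
  horizontal.\<close>

lemma h_phi:
  assumes X: "X \<in> V"
  shows "h (\<phi> X) = - \<phi> (h X)"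
proof -
  note [simp] = X phi_closed h_closed V_closed D_closed xi_closed eta_closed eta_h eta_phi
  have "cov_deriv D \<phi> \<xi> (\<phi> X) + \<phi> (cov_deriv D \<phi> \<xi> X) = cov_deriv D (\<lambda>X. \<phi> (\<phi> X)) \<xi> X"
    by (simp add: cov_compose[OF phi_tensor phi_tensor])
  also have "\<dots> = (vf_apply \<xi> (\<eta> X) - \<eta> (D \<xi> X)) \<cdot> \<xi>"
    by (simp add: cov_deriv_def phi_phi D_diff D_add D_uminus D_scale D_xi_xi vf_apply_smooth)
       (simp add: vf_scale_def fun_eq_iff algebra_simps)
  \<comment> \<open>\<eta> is parallel along \<xi>, because
    \<open>D \<xi> \<xi> = 0\<close>.\<close>
  also have "vf_apply \<xi> (\<eta> X) = \<eta> (D \<xi> X)"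
    using form_zero[OF g_form_right[of X] xi_closed]
    by (simp add: eta_eq metric_compatible D_xi_xi)
  finally have "\<phi> (h (\<phi> X)) + \<phi> (\<phi> (h X)) = 0"
    by (simp add: cov_phi_xi_left vf_scale_def fun_eq_iff)
  then have "\<phi> (\<phi> (h (\<phi> X) + \<phi> (h X))) = 0"
    using tensor_zero[OF phi_tensor xi_closed] by (simp add: phi_linear del: phi_phi)
  then have "h (\<phi> X) + \<phi> (h X) = 0"
    by (simp add: phi_phi eta_linear) (simp add: vf_scale_def fun_eq_iff add_eq_0_iff)
  then show ?thesis
    by (simp add: eq_neg_iff_add_eq_0)
qed

lemma h_skew: "skew h"
  unfolding skew_def
proof (intro ballI ext)
  fix X Y p assume X: "X \<in> V" and Y: "Y \<in> V"
  note [simp] = X Y phi_closed h_closed eta_h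
  have "g (h X) Y p = g (\<phi> (h X)) (\<phi> Y) p"
    by (simp add: g_phi_phi)
  also have "\<dots> = - g X (\<phi> (h (\<phi> Y))) p"
    using skewD[OF phi_h_skew, of X "\<phi> Y"] by simp
  also have "\<phi> (h (\<phi> Y)) = h Y"
    by (simp add: h_phi phi_linear phi_phi) (simp add: vf_scale_def fun_eq_iff)
  finally show "g (h X) Y p = (- g X (h Y)) p"
    by simp
qed

text \<open>Differentiating \<open>\<phi>h + h\<phi> = 0\<close>.\<close>

lemma cov_phi_h:
  assumes "X \<in> V" "Y \<in> V" "Z \<in> V"
  shows "g (cov_deriv D h X (\<phi> Y)) Z p - g (cov_deriv D h X Y) (\<phi> Z) p
    = g (cov_deriv D \<phi> X Y) (h Z) p - g (cov_deriv D \<phi> X (h Y)) Z p"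
proof -
  note [simp] = assms phi_closed h_closed cov_closed[OF phi_tensor] cov_closed[OF h_tensor] D_closed V_closed
  have "cov_deriv D h X (\<phi> Y) + h (cov_deriv D \<phi> X Y) + (cov_deriv D \<phi> X (h Y) + \<phi> (cov_deriv D h X Y))
    = cov_deriv D (\<lambda>X. h (\<phi> X)) X Y + cov_deriv D (\<lambda>X. \<phi> (h X)) X Y"
    by (simp add: cov_compose[OF phi_tensor h_tensor] cov_compose[OF h_tensor phi_tensor])
  also have "\<dots> = 0"
    by (simp add: cov_deriv_def h_phi D_uminus)
  finally have "g (cov_deriv D h X (\<phi> Y) + h (cov_deriv D \<phi> X Y)
      + (cov_deriv D \<phi> X (h Y) + \<phi> (cov_deriv D h X Y))) Z p = g 0 Z p"
    by simp
  also have "\<dots> = 0"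
    using form_zero[OF g_form_left[of Z] assms(1)] by simp
  finally show ?thesis
    by (simp add: g_linear skewD[OF phi_skew] skewD[OF h_skew])
qed

text \<open>\<xi> is Killing because \<open>- \<phi> + h\<close> is skew, so
  \<open>cov_Killing_cyclic\<close> applies to this difference.\<close>

lemma cov_cyclic:
  assumes "X \<in> V" "Y \<in> V" "Z \<in> V"
  shows "g (cov_deriv D h X Y) Z p + g (cov_deriv D h Y Z) X p + g (cov_deriv D h Z X) Y p
    = g (cov_deriv D \<phi> X Y) Z p + g (cov_deriv D \<phi> Y Z) X p + g (cov_deriv D \<phi> Z X) Y p"
proof -
  let ?B = "\<lambda>X. D X \<xi>"
  note B = D_tensor[OF xi_closed]
  have "skew ?B"
    using skewD[OF phi_skew] skewD[OF h_skew]
    by (simp add: skew_def D_xi g_linear V_closed phi_closed h_closed fun_eq_iff)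
  then have "g (cov_deriv D ?B X Y) Z p + g (cov_deriv D ?B Y Z) X p + g (cov_deriv D ?B Z X) Y p = 0"
    using assms by (intro cov_Killing_cyclic[OF B]) (simp_all add: xi_closed)
  moreover have "cov_deriv D ?B X Y = cov_deriv D h X Y - cov_deriv D \<phi> X Y" if "X \<in> V" "Y \<in> V" for X Y
    using that by (simp add: cov_deriv_def D_xi D_closed D_diff D_add D_uminus phi_closed h_closed V_closed)
  ultimately show ?thesis
    using assms by (simp add: g_linear cov_closed phi_tensor h_tensor)
qed

end

section \<open>Nearly Sasakian structures with prescribed square of \<open>h\<close>\<close>

locale nearly_sasakian_square_atlas = nearly_sasakian_atlas A g D \<phi> \<xi> \<eta> h
  for A :: "('m::{t2_space,second_countable_topology}, 'e::euclidean_space) chart set"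
    and g D \<phi> \<xi> \<eta> h +
  fixes l :: real
  assumes l_nonzero: "l \<noteq> 0"
    and h_h: "X \<in> V \<Longrightarrow> h (h X) = (- l\<^sup>2) \<cdot>\<^sub>\<real> (X - \<eta> X \<cdot> \<xi>)"
begin

lemma h_h_hor: "X \<in> V \<Longrightarrow> h (h X) = (- l\<^sup>2) \<cdot>\<^sub>\<real> hor X"
  by (simp add: h_h hor_def)

lemma phi_phi_hor: "X \<in> V \<Longrightarrow> \<phi> (\<phi> X) = (- 1) \<cdot>\<^sub>\<real> hor X"
  by (simp add: phi_phi hor_def) (simp add: vf_scaleR_def vf_scale_def fun_eq_iff)

lemma three_tensors:
  "quaternionic_three_tensors horizontal (\<lambda>X. (1 / l) \<cdot>\<^sub>\<real> h X) \<phi>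
    (\<lambda>X Y Z. g (cov_deriv D \<phi> X Y) Z p) (\<lambda>X Y Z. g (cov_deriv D h X Y) Z p) l"
proof -
  note [simp] = phi_closed h_closed V_closed eta_phi eta_h cov_closed[OF phi_tensor] cov_closed[OF h_tensor]
    h_linear phi_linear g_linear eta_linear h_phi C_closed
  note cov_linear = tensor_linear[OF cov_tensor_left[OF phi_tensor]] tensor_linear[OF cov_tensor_right[OF phi_tensor]]
    tensor_linear[OF cov_tensor_left[OF h_tensor]] tensor_linear[OF cov_tensor_right[OF h_tensor]]
  have skew: "g (cov_deriv D F X Y) Z p = - g (cov_deriv D F X Z) Y p"
    if "tensor_1_1 A F" "skew F" "X \<in> V" "Y \<in> V" "Z \<in> V" for F X Y Z
    using skewD[OF cov_skew[OF that(1-3)] that(4,5), of p]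
      g_sym[OF that(4) cov_closed[OF that(1) that(3) that(5)]] by simp
  \<comment> \<open>The \<eta> terms vanish on horizontal fields and the \<xi> term is orthogonal to
    \<open>Z\<close>.\<close>
  have sym: "g (cov_deriv D \<phi> X Y) Z p = - g (cov_deriv D \<phi> Y X) Z p"
    if "X \<in> horizontal" "Y \<in> horizontal" "Z \<in> horizontal" for X Y Z
  proof -
    note [simp] = that[THEN horizontalD(1)] that[THEN horizontalD(2)] xi_closed g_closed
    have "g \<xi> Z p = 0"
      using eta_eq[of Z] g_sym[of \<xi> Z] by simp
    then have "g (cov_deriv D \<phi> X Y + cov_deriv D \<phi> Y X) Z p = 0"
      by (simp add: cov_phi_sym del: plus_fun_apply)
    then show ?thesis
      by simp
  qed
  show ?thesis
  proof
    fix X Y Z assume "X \<in> horizontal" "Y \<in> horizontal" "Z \<in> horizontal"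
    note hv = this
    note [simp] = hv[THEN horizontalD(1)] hv[THEN horizontalD(2)]
    show "g (cov_deriv D \<phi> X Y) Z p = - g (cov_deriv D \<phi> Y X) Z p"
      by (rule sym) fact+
    show "g (cov_deriv D \<phi> X Y) Z p = - g (cov_deriv D \<phi> X Z) Y p"
      by (rule skew) (simp_all add: phi_tensor phi_skew)
    show "g (cov_deriv D h X Y) Z p = - g (cov_deriv D h X Z) Y p"
      by (rule skew) (simp_all add: h_tensor h_skew)
    show "g (cov_deriv D \<phi> X (\<phi> Y)) Z p = g (cov_deriv D \<phi> X Y) (\<phi> Z) p"
      using hv by (intro cov_square[OF phi_tensor phi_skew]) (auto intro: phi_phi_hor)
    have "g (cov_deriv D h X (h Y)) Z p = g (cov_deriv D h X Y) (h Z) p"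
      using hv by (intro cov_square[OF h_tensor h_skew]) (auto intro: h_h_hor)
    then show "g (cov_deriv D h X ((1 / l) \<cdot>\<^sub>\<real> h Y)) Z p = g (cov_deriv D h X Y) ((1 / l) \<cdot>\<^sub>\<real> h Z) p"
      by (simp add: cov_linear)
    show "g (cov_deriv D h X (\<phi> Y)) Z p - g (cov_deriv D h X Y) (\<phi> Z) p
        = l * (g (cov_deriv D \<phi> X Y) ((1 / l) \<cdot>\<^sub>\<real> h Z) p - g (cov_deriv D \<phi> X ((1 / l) \<cdot>\<^sub>\<real> h Y)) Z p)"
      using l_nonzero by (simp add: cov_phi_h cov_linear right_diff_distrib)
    \<comment> \<open>The factor 3 arises because the form from \<open>\<phi>\<close> is totally
      skew, hence invariant under cyclic shifts.\<close>
    show "g (cov_deriv D h X Y) Z p + g (cov_deriv D h Y Z) X p + g (cov_deriv D h Z X) Y p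
        = 3 * g (cov_deriv D \<phi> X Y) Z p"
      using sym[of X Y Z] sym[of Y Z X] sym[of Z X Y] skew[OF phi_tensor phi_skew, of X Y Z]
        skew[OF phi_tensor phi_skew, of Y Z X] skew[OF phi_tensor phi_skew, of Z X Y] hv
      by (simp add: cov_cyclic)
  qed (auto simp: horizontal_def cov_linear phi_phi h_h power2_eq_square,
      auto simp: l_nonzero vf_scale_def vf_scaleR_def fun_eq_iff)
qed

section \<open>Components of the two covariant derivatives\<close>

lemma eta_cov:
  assumes F: "tensor_1_1 A F" and "skew F" "X \<in> V" "Y \<in> V"
  shows "\<eta> (cov_deriv D F X Y) = - g Y (cov_deriv D F X \<xi>)"
  using cov_skew[OF F assms(2,3)] assms xi_closed by (simp add: eta_eq cov_closed skew_def)

text \<open>The horizontal part vanishes by the quaternionic argument; skewness determines the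
  vertical part.\<close>

lemma cov_hor_hor:
  assumes "X \<in> V" "Y \<in> V"
  shows "cov_deriv D \<phi> (hor X) (hor Y) = (- g (hor Y) (cov_deriv D \<phi> (hor X) \<xi>)) \<cdot> \<xi>"
    and "cov_deriv D h (hor X) (hor Y) = (- g (hor Y) (cov_deriv D h (hor X) \<xi>)) \<cdot> \<xi>"
proof -
  have *: "cov_deriv D F (hor X) (hor Y) = (- g (hor Y) (cov_deriv D F (hor X) \<xi>)) \<cdot> \<xi>"
    if "tensor_1_1 A F" "skew F"
      "\<And>Z p. Z \<in> horizontal \<Longrightarrow> g (cov_deriv D F (hor X) (hor Y)) Z p = 0" for F
    using vertical_if_orthogonal[OF cov_closed[OF that(1)], of "hor X" "hor Y"] assms that
    by (simp add: eta_cov hor_closed)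
  show "cov_deriv D \<phi> (hor X) (hor Y) = (- g (hor Y) (cov_deriv D \<phi> (hor X) \<xi>)) \<cdot> \<xi>"
    using quaternionic_three_tensors.P_zero[OF three_tensors] assms
    by (intro * phi_tensor phi_skew) (simp add: hor_horizontal)
  show "cov_deriv D h (hor X) (hor Y) = (- g (hor Y) (cov_deriv D h (hor X) \<xi>)) \<cdot> \<xi>"
    using quaternionic_three_tensors.Q_zero[OF three_tensors] assms
    by (intro * h_tensor h_skew) (simp add: hor_horizontal)
qed

lemma cov_decomp:
  assumes F: "tensor_1_1 A F" and X: "X \<in> V" and Y: "Y \<in> V"
  shows "cov_deriv D F X Y = cov_deriv D F (hor X) (hor Y) + \<eta> X \<cdot> cov_deriv D F \<xi> (hor Y)
    + \<eta> Y \<cdot> cov_deriv D F X \<xi>"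
proof -
  note [simp] = X Y xi_closed hor_closed V_closed eta_closed cov_closed[OF F]
  have "cov_deriv D F X Y = cov_deriv D F X (hor Y + \<eta> Y \<cdot> \<xi>)"
    by (simp flip: hor_decomp)
  also have "\<dots> = cov_deriv D F X (hor Y) + \<eta> Y \<cdot> cov_deriv D F X \<xi>"
    by (simp add: tensor_linear[OF cov_tensor_right[OF F]])
  also have "cov_deriv D F X (hor Y) = cov_deriv D F (hor X + \<eta> X \<cdot> \<xi>) (hor Y)"
    by (simp flip: hor_decomp)
  also have "\<dots> = cov_deriv D F (hor X) (hor Y) + \<eta> X \<cdot> cov_deriv D F \<xi> (hor Y)"
    by (simp add: tensor_linear[OF cov_tensor_left[OF F]])
  finally show ?thesis .
qed

lemma h_hor: "X \<in> V \<Longrightarrow> h (hor X) = h X"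
  by (simp add: hor_def h_linear V_closed eta_closed xi_closed h_xi) (simp add: vf_scale_def fun_eq_iff)

lemma phi_hor: "X \<in> V \<Longrightarrow> \<phi> (hor X) = \<phi> X"
  by (simp add: hor_def phi_linear V_closed eta_closed xi_closed phi_xi) (simp add: vf_scale_def fun_eq_iff)

lemma eta_hor: "X \<in> V \<Longrightarrow> \<eta> (hor X) = 0"
  using hor_horizontal horizontalD(2) by blast

lemma cov_h_xi_right:
  assumes "X \<in> V"
  shows "cov_deriv D h X \<xi> = l\<^sup>2 \<cdot>\<^sub>\<real> hor X - \<phi> (h X)"
  using assms by (simp add: cov_deriv_def h_xi D_zero D_xi h_linear phi_closed h_closed V_closed h_h_hor h_phi)
    (simp add: vf_scaleR_def fun_eq_iff)

text \<open>The remaining component of \<open>\<nabla>h\<close> comes from the cyclic identity.\<close>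

lemma cov_h_xi_left:
  assumes Y: "Y \<in> horizontal"
  shows "cov_deriv D h \<xi> Y = \<phi> (h Y)"
proof -
  note [simp] = horizontalD[OF Y] xi_closed phi_closed h_closed V_closed eta_phi eta_h
    cov_closed[OF h_tensor] cov_closed[OF phi_tensor] g_linear
  define W where "W = cov_deriv D h \<xi> Y - \<phi> (h Y)"
  have W: "W \<in> V"
    by (simp add: W_def)
  have hor_id: "hor X = X" if "X \<in> horizontal" for X
    using horizontalD(2)[OF that] by (simp add: hor_def vf_scale_def fun_eq_iff)
  have "W = \<eta> W \<cdot> \<xi>"
  proof (rule vertical_if_orthogonal[OF W])
    fix Z p assume Z: "Z \<in> horizontal"
    note [simp] = horizontalD[OF Z]
    have xi0: "g \<xi> Z p = 0" "g \<xi> Y p = 0"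
      using eta_eq[of Z] eta_eq[of Y] g_sym[of \<xi> Z] g_sym[of \<xi> Y] by simp_all
    have 1: "g (cov_deriv D F X U) \<xi> p = - g U (cov_deriv D F X \<xi>) p"
      if "tensor_1_1 A F" "skew F" "X \<in> V" "U \<in> V" for F X U
      using eta_cov[OF that] that eta_eq[of "cov_deriv D F X U"] by (simp add: cov_closed)
    have 2: "g Z (\<phi> (h Y)) p = - g Y (\<phi> (h Z)) p" "g (\<phi> (h Y)) Z p = - g Y (\<phi> (h Z)) p"
      "g (\<phi> (h Z)) Y p = g Y (\<phi> (h Z)) p" "g Z Y p = g Y Z p"
      using skewD[OF phi_h_skew, of Y Z] g_sym[of Z "\<phi> (h Y)"] g_sym[of Y "\<phi> (h Z)"] g_sym[of Z Y]
      by simp_all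
    \<comment> \<open>The symmetric terms in \<open>g Y Z\<close> cancel; what remains is 2 copies
      of \<open>g (\<phi> (h Y)) Z p\<close> on the left and 3 on the right.\<close>
    have "g (cov_deriv D h \<xi> Y) Z p = g (\<phi> (h Y)) Z p"
      using cov_cyclic[of \<xi> Y Z p] xi0 2
      by (simp add: 1 h_tensor phi_tensor h_skew phi_skew cov_h_xi_right cov_phi_xi_right
          cov_phi_xi_left hor_id Y Z scale_zero)
    then show "g W Z p = 0"
      by (simp add: W_def)
  qed
  \<comment> \<open>By skewness this reduces to the derivative of \<open>h\<close> along \<xi> at
    \<xi>, which is zero.\<close>
  moreover have "\<eta> W = 0"
    using form_zero[OF g_form_right[of Y], of Y]
    by (simp add: W_def eta_linear eta_cov h_tensor h_skew)
       (simp add: cov_deriv_def h_xi D_zero D_xi_xi tensor_zero[OF h_tensor, of Y])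
  ultimately have "W = 0"
    by (simp add: vf_scale_def fun_eq_iff)
  then show ?thesis
    by (simp add: W_def)
qed

text \<open>Assembles the components from \<open>cov_decomp\<close>; only the horizontal pair needs
  the vanishing of \<open>P\<close>.\<close>

lemma cov_phi_formula:
  assumes "X \<in> V" "Y \<in> V"
  shows "cov_deriv D \<phi> X Y = g (X + \<phi> (h X)) Y \<cdot> \<xi> - \<eta> Y \<cdot> (X + \<phi> (h X)) + \<eta> X \<cdot> \<phi> (h Y)"
proof -
  note [simp] = assms xi_closed phi_closed h_closed V_closed eta_closed hor_closed
  have "g (hor Y) (cov_deriv D \<phi> (hor X) \<xi>) = - g (X + \<phi> (h X)) Y + \<eta> X * \<eta> Y"
    by (simp add: cov_phi_xi_right eta_hor h_hor scale_zero)
      (simp add: hor_def g_linear,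
        simp add: g_sym[of Y] g_sym[of \<xi>] eta_phi eta_xi fun_eq_iff algebra_simps flip: eta_eq)
  then show ?thesis
    by (simp add: cov_decomp[OF phi_tensor, of X Y] cov_hor_hor cov_phi_xi_left cov_phi_xi_right h_hor)
      (simp add: vf_scale_def fun_eq_iff algebra_simps)
qed

text \<open>All terms with \<open>\<phi> h\<close> agree for the two derivatives, so the difference
  is a multiple of the Sasakian expression.\<close>

lemma cov_h_formula:
  assumes "X \<in> V" "Y \<in> V"
  shows "cov_deriv D h X Y = cov_deriv D \<phi> X Y - (1 + l\<^sup>2) \<cdot>\<^sub>\<real> (g X Y \<cdot> \<xi> - \<eta> Y \<cdot> X)"
proof -
  note [simp] = assms xi_closed phi_closed h_closed V_closed eta_closed hor_closed
  have "g (hor Y) (cov_deriv D h (hor X) \<xi>) = (\<lambda>_. l\<^sup>2) * (g X Y - \<eta> X * \<eta> Y) - g (\<phi> (h X)) Y"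
    by (simp add: cov_h_xi_right h_hor hor_horizontal)
      (simp add: hor_def g_linear,
        simp add: g_sym[of Y] g_sym[of \<xi>] eta_phi eta_xi fun_eq_iff algebra_simps flip: eta_eq)
  then show ?thesis
    by (simp add: cov_decomp[OF h_tensor, of X Y] cov_hor_hor cov_h_xi_left hor_horizontal
        cov_h_xi_right h_hor cov_phi_formula g_linear)
      (simp add: hor_def vf_scale_def vf_scaleR_def fun_eq_iff algebra_simps)
qed

text \<open>If \<open>R\<close> is the nearly Sasakian right-hand side, symmetrizing gives
  \<open>R\<close> minus \<open>1 + l * l\<close> times \<open>R\<close>.\<close>

lemma cov_h_sym:
  assumes "X \<in> V" "Y \<in> V"
  shows "cov_deriv D h X Y + cov_deriv D h Y X = (- l\<^sup>2) \<cdot>\<^sub>\<real> (2 \<cdot>\<^sub>\<real> g X Y \<cdot> \<xi> - \<eta> X \<cdot> Y - \<eta> Y \<cdot> X)"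
proof -
  have "cov_deriv D h X Y + cov_deriv D h Y X = (cov_deriv D \<phi> X Y + cov_deriv D \<phi> Y X)
      - (1 + l\<^sup>2) \<cdot>\<^sub>\<real> (g X Y \<cdot> \<xi> - \<eta> Y \<cdot> X) - (1 + l\<^sup>2) \<cdot>\<^sub>\<real> (g Y X \<cdot> \<xi> - \<eta> X \<cdot> Y)"
    using assms by (simp add: cov_h_formula)
  then show ?thesis
    using assms by (simp add: cov_phi_sym g_sym[of Y X])
      (simp add: vf_scale_def vf_scaleR_def fun_eq_iff algebra_simps)
qed

text \<open>By the Leibniz rule two contributions arise, and they are opposite; the \<xi> components
  cancel by skewness of \<open>h\<close> and \<open>\<phi>\<close>.\<close>

lemma cov_phi_h_sym:
  assumes "X \<in> V" "Y \<in> V"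
  shows "cov_deriv D (\<lambda>X. \<phi> (h X)) X Y + cov_deriv D (\<lambda>X. \<phi> (h X)) Y X = 0"
proof -
  note [simp] = assms xi_closed phi_closed h_closed V_closed eta_closed g_closed cov_closed[OF h_tensor] eta_phi eta_h
  have hh: "\<phi> (h (h X)) = (- l\<^sup>2) \<cdot>\<^sub>\<real> \<phi> X" if "X \<in> V" for X
    using that by (simp add: h_h_hor phi_linear hor_closed phi_hor)
  have "g (\<phi> (h X)) (h Y) p = - l\<^sup>2 * g (\<phi> X) Y p" if "X \<in> V" "Y \<in> V" for X Y p
    using that skewD[OF h_skew, of "\<phi> (h X)" Y p] by (simp add: h_phi hh g_linear)
  then have phi_h: "g (\<phi> (h X)) (h Y) p + g (\<phi> (h Y)) (h X) p = 0" for p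
    using skewD[OF phi_skew, of X Y] g_sym[of X "\<phi> Y"] by simp
  have h: "g X (h Y) p + g Y (h X) p = 0" for p
    using skewD[OF h_skew, of X Y] g_sym[of Y "h X"] by simp
  have gg: "g (X + \<phi> (h X)) (h Y) + g (Y + \<phi> (h Y)) (h X) = 0"
  proof
    fix p
    have "(g (X + \<phi> (h X)) (h Y) + g (Y + \<phi> (h Y)) (h X)) p
        = (g X (h Y) p + g Y (h X) p) + (g (\<phi> (h X)) (h Y) p + g (\<phi> (h Y)) (h X) p)"
      by (simp add: g_linear)
    then show "(g (X + \<phi> (h X)) (h Y) + g (Y + \<phi> (h Y)) (h X)) p = 0 p"
      unfolding phi_h h by simp
  qed
  have cov_phi: "cov_deriv D \<phi> X (h Y) = g (X + \<phi> (h X)) (h Y) \<cdot> \<xi> + (- l\<^sup>2) \<cdot>\<^sub>\<real> \<eta> X \<cdot> \<phi> Y"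
    if "X \<in> V" "Y \<in> V" for X Y
    using cov_phi_formula[OF that(1) h_closed[OF that(2)]] that
    by (simp add: hh eta_h scale_zero) (simp add: vf_scaleR_def vf_scale_def fun_eq_iff)
  have "cov_deriv D (\<lambda>X. \<phi> (h X)) X Y + cov_deriv D (\<lambda>X. \<phi> (h X)) Y X
      = (cov_deriv D \<phi> X (h Y) + cov_deriv D \<phi> Y (h X)) + \<phi> (cov_deriv D h X Y + cov_deriv D h Y X)"
    by (simp add: cov_compose[OF phi_tensor h_tensor] phi_linear)
  moreover have "\<phi> (cov_deriv D h X Y + cov_deriv D h Y X)
      = (- l\<^sup>2) \<cdot>\<^sub>\<real> (- \<eta> X \<cdot> \<phi> Y - \<eta> Y \<cdot> \<phi> X)"
    by (simp only: cov_h_sym assms) (simp add: phi_linear phi_xi,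
      simp add: vf_scaleR_def vf_scale_def fun_eq_iff)
  moreover have "cov_deriv D \<phi> X (h Y) + cov_deriv D \<phi> Y (h X)
      = (- l\<^sup>2) \<cdot>\<^sub>\<real> (\<eta> X \<cdot> \<phi> Y + \<eta> Y \<cdot> \<phi> X)"
    by (simp only: cov_phi assms scale_scaleR_add gg scale_zero add_0_left)
  ultimately show ?thesis
    by (simp only:) (simp add: vf_scaleR_def vf_scale_def fun_eq_iff algebra_simps)
qed

section \<open>The structures induced by \<open>h\<close> and \<open>\<phi> h\<close>\<close>

lemma g_h_h: "X \<in> V \<Longrightarrow> Y \<in> V \<Longrightarrow> g (h X) (h Y) p = l\<^sup>2 * (g X Y p - \<eta> X p * \<eta> Y p)"
  using skewD[OF h_skew, of X "h Y"]
  by (simp add: h_closed h_h g_linear V_closed eta_closed xi_closed flip: eta_eq)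

lemma almost_contact_h: "almost_contact_metric A (\<lambda>X. (1 / l) \<cdot>\<^sub>\<real> h X) \<xi> \<eta> g"
proof -
  have "(1 / l) \<cdot>\<^sub>\<real> h ((1 / l) \<cdot>\<^sub>\<real> h X) = - X + \<eta> X \<cdot> \<xi>" if "X \<in> V" for X
    using that l_nonzero by (simp add: h_linear h_closed h_h)
      (simp add: vf_scaleR_def vf_scale_def fun_eq_iff power2_eq_square)
  moreover have "g ((1 / l) \<cdot>\<^sub>\<real> h X) ((1 / l) \<cdot>\<^sub>\<real> h Y) = g X Y - \<eta> X * \<eta> Y" if "X \<in> V" "Y \<in> V" for X Y
    using that l_nonzero
    by (simp add: g_linear h_closed V_closed) (simp add: g_h_h fun_eq_iff power2_eq_square)
  ultimately show ?thesis
    unfolding almost_contact_metric_def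
    by (simp add: tensor_scaleR_fun h_tensor xi_closed eta_form metric eta_xi)
qed

lemma almost_contact_phi_h: "almost_contact_metric A (\<lambda>X. (1 / l) \<cdot>\<^sub>\<real> \<phi> (h X)) \<xi> \<eta> g"
proof -
  \<comment> \<open>Anticommuting and squaring \<open>\<phi>\<close> each contribute a sign, and
    they cancel.\<close>
  have "\<phi> (h (\<phi> (h X))) = h (h X)" if "X \<in> V" for X
    using that by (simp add: h_phi phi_linear phi_closed h_closed phi_phi eta_h scale_zero)
  then have "(1 / l) \<cdot>\<^sub>\<real> \<phi> (h ((1 / l) \<cdot>\<^sub>\<real> \<phi> (h X))) = - X + \<eta> X \<cdot> \<xi>" if "X \<in> V" for X
    using that l_nonzero by (simp add: h_linear phi_linear phi_closed h_closed h_h)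
      (simp add: vf_scaleR_def vf_scale_def fun_eq_iff power2_eq_square)
  moreover have "g ((1 / l) \<cdot>\<^sub>\<real> \<phi> (h X)) ((1 / l) \<cdot>\<^sub>\<real> \<phi> (h Y)) = g X Y - \<eta> X * \<eta> Y"
    if "X \<in> V" "Y \<in> V" for X Y
    using that l_nonzero
    by (simp add: g_linear h_closed phi_closed V_closed g_phi_phi eta_h)
      (simp add: g_h_h fun_eq_iff power2_eq_square)
  ultimately show ?thesis
    unfolding almost_contact_metric_def
    by (simp add: tensor_scaleR_fun tensor_compose[OF phi_tensor h_tensor] xi_closed eta_form metric eta_xi)
qed

lemma nearly_alpha_sasakian_h: "nearly_alpha_sasakian A D (- l) (\<lambda>X. (1 / l) \<cdot>\<^sub>\<real> h X) \<xi> \<eta> g"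
proof -
  have "cov_deriv D (\<lambda>X. (1 / l) \<cdot>\<^sub>\<real> h X) X Y + cov_deriv D (\<lambda>X. (1 / l) \<cdot>\<^sub>\<real> h X) Y X
      = (- l) \<cdot>\<^sub>\<real> (2 \<cdot>\<^sub>\<real> g X Y \<cdot> \<xi> - \<eta> X \<cdot> Y - \<eta> Y \<cdot> X)" (is "?L = ?R") if "X \<in> V" "Y \<in> V" for X Y
  proof -
    have "?L = (1 / l) \<cdot>\<^sub>\<real> (cov_deriv D h X Y + cov_deriv D h Y X)"
      using that by (simp add: cov_scaleR[OF h_tensor])
        (simp add: vf_scaleR_def fun_eq_iff add_divide_distrib)
    also have "\<dots> = (1 / l) \<cdot>\<^sub>\<real> (- l\<^sup>2) \<cdot>\<^sub>\<real> (2 \<cdot>\<^sub>\<real> g X Y \<cdot> \<xi> - \<eta> X \<cdot> Y - \<eta> Y \<cdot> X)"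
      by (simp only: cov_h_sym that)
    also have "\<dots> = ?R"
      using l_nonzero by (simp add: vf_scaleR_def fun_eq_iff power2_eq_square)
    finally show ?thesis .
  qed
  then show ?thesis
    using l_nonzero almost_contact_h by (simp add: nearly_alpha_sasakian_def)
qed

lemma nearly_cosymplectic_phi_h: "nearly_cosymplectic A D (\<lambda>X. (1 / l) \<cdot>\<^sub>\<real> \<phi> (h X)) \<xi> \<eta> g"
proof -
  have "cov_deriv D (\<lambda>X. (1 / l) \<cdot>\<^sub>\<real> \<phi> (h X)) X Y + cov_deriv D (\<lambda>X. (1 / l) \<cdot>\<^sub>\<real> \<phi> (h X)) Y X = 0"
    (is "?L = 0") if "X \<in> V" "Y \<in> V" for X Y
  proof -
    have "?L = (1 / l) \<cdot>\<^sub>\<real> (cov_deriv D (\<lambda>X. \<phi> (h X)) X Y + cov_deriv D (\<lambda>X. \<phi> (h X)) Y X)"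
      using that by (simp add: cov_scaleR[OF tensor_compose[OF phi_tensor h_tensor]])
        (simp add: vf_scaleR_def fun_eq_iff add_divide_distrib)
    then show ?thesis
      by (simp only: cov_phi_h_sym that) (simp add: vf_scaleR_def fun_eq_iff)
  qed
  then show ?thesis
    using almost_contact_phi_h by (simp add: nearly_cosymplectic_def)
qed

end

theorem theorem4p6:
  fixes A :: "('m::{t2_space,second_countable_topology}, real ^ 5) chart set"
    and \<phi> h \<phi>\<^sub>1 \<phi>\<^sub>2 :: "'m vfield \<Rightarrow> 'm vfield"
    and \<xi> :: "'m vfield"
    and \<eta> :: "'m vfield \<Rightarrow> 'm \<Rightarrow> real"
    and g :: "'m vfield \<Rightarrow> 'm vfield \<Rightarrow> 'm \<Rightarrow> real"
    and D :: "'m vfield \<Rightarrow> 'm vfield \<Rightarrow> 'm vfield"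
    and l :: real
  assumes "smooth_manifold A"
    and "connected (UNIV :: 'm set)"
    and "levi_civita A g D"
    and "nearly_sasakian A D \<phi> \<xi> \<eta> g"
    and "\<not> sasakian A D \<phi> \<xi> \<eta> g"
    and "\<And>X. X \<in> vector_fields A \<Longrightarrow> D X \<xi> = - \<phi> X + h X"
    and "l \<noteq> 0"
    and "\<And>X. X \<in> vector_fields A \<Longrightarrow> h (h X) = (- l\<^sup>2) \<cdot>\<^sub>\<real> (X - \<eta> X \<cdot> \<xi>)"
    and "\<phi>\<^sub>1 = (\<lambda>X. (1 / l) \<cdot>\<^sub>\<real> h X)"
    and "\<phi>\<^sub>2 = (\<lambda>X. (1 / l) \<cdot>\<^sub>\<real> \<phi> (h X))"
  shows "nearly_cosymplectic A D \<phi>\<^sub>2 \<xi> \<eta> g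
    \<and> nearly_alpha_sasakian A D (- l) \<phi>\<^sub>1 \<xi> \<eta> g"
proof -
  \<comment> \<open>The nearly Sasakian hypothesis supplies the metric and the almost contact metric
    structure for the parent locales.\<close>
  interpret nearly_sasakian_square_atlas A g D \<phi> \<xi> \<eta> h l
    using assms(1,3,4,6-8) by unfold_locales (auto simp: nearly_sasakian_def almost_contact_metric_def)
  show ?thesis
    unfolding assms(9,10) using nearly_cosymplectic_phi_h nearly_alpha_sasakian_h by blast
qed

end
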